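(* Let $A$ be a commutative associative algebra over $\mathbb{Q}$ with a derivation $\partial$, regarded as a left Novikov (hence left pre-Lie) algebra with product $a\triangleright b:=a\,\partial(b)$. Then the map $\eta:U(A)\to A$ is explicitly given by $$\eta(f_1\otimes\cdots\otimes f_i)=\sum_{w=w_1\cdots w_i\in K_i} c_w\,\partial^{w_1}(f_1)\cdots\partial^{w_i}(f_i)$$ for all $f_1,\ldots,f_i\in A$ and all $i\ge 1$.
   Context: $U(A)$ is the enveloping algebra of the Lie algebra $(A,[a,b]=a\triangleright b-b\triangleright a)$, realized as the quotient of the tensor algebra of $A$ by the ideal generated by $a\otimes b-b\otimes a-[a,b]$; $f_1\otimes\cdots\otimes f_i$ denotes the class of the tensor. The left symmetric braces of $A$ are $\{a_1\cdots a_n\}a=a_1\cdots a_n\partial^n(a)$, and the symmetric algebra $\mathbb{Q}[A]$ (whose product is denoted $\odot$) carries the associative product $$(z_1\odot\cdots\odot z_m)\ast^{op}(w_1\odot\cdots\odot w_n)=\sum_{I_1\sqcup\cdots\sqcup I_{n+1}=[m]}(\{z_{I_1}\}w_1)\odot\cdots\odot(\{z_{I_n}\}w_n)\odot z_{I_{n+1}}$$ (blocks may be empty, $z_I=\bigodot_{i\in I}z_i$). The map $\eta$ is the composite of the isomorphism $U(A)\to(\mathbb{Q}[A],\ast^{op})$, $f_1\otimes\cdots\otimes f_i\mapsto f_1\ast^{op}\cdots\ast^{op}f_i$, with the projection $\mathbb{Q}[A]\to A$ onto the degree one component; equivalently $$\eta(f_1\otimes\cdots\otimes f_i)=f_1\triangleright(f_2\triangleright(\cdots\triangleright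 f_i))=(f_1\partial)\circ\cdots\circ(f_{i-1}\partial)(f_i).$$ For $i\ge1$, $K_i$ is the set of words $w=w_1\cdots w_i$ of length $i$ in nonnegative integers such that $w_1+\cdots+w_j\le j-1$ for all $1\le j<i$ and $w_1+\cdots+w_i=i-1$. For $w\in K_i$ set $d_j:=j-1-w_1-\cdots-w_j$ for $1\le j\le i$ and $$c_w:=\prod_{j=1}^i\binom{d_j+w_j}{w_j}.$$ *)

theory Defs
  imports
    "HOL-Algebra.QuotRing"
    "HOL-Algebra.Algebraic_Closure_Type"
    "HOL-Library.Poly_Mapping"
    "HOL-Library.FuncSet"
begin

text \<open>
  The algebra \<open>A\<close> is a whole type of class \<^class>\<open>comm_ring\<close>, so it need not have a unit; \<open>sc\<close> is its
  scalar multiplication and \<open>D\<close> the derivation.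
\<close>

locale differential_rat_algebra = vector_space sc
  for sc :: "rat \<Rightarrow> 'a::comm_ring \<Rightarrow> 'a" +
  fixes D :: "'a \<Rightarrow> 'a"
  assumes sc_mult: "sc q a * b = sc q (a * b)"
    and D_add: "D (a + b) = D a + D b"
    and D_sc: "D (sc q a) = sc q (D a)"
    and D_mult: "D (a * b) = D a * b + a * D b"

definition prelie :: "('a::comm_ring \<Rightarrow> 'a) \<Rightarrow> 'a \<Rightarrow> 'a \<Rightarrow> 'a" where
  "prelie D a b = a * D b"

definition lie_bracket :: "('a::comm_ring \<Rightarrow> 'a) \<Rightarrow> 'a \<Rightarrow> 'a \<Rightarrow> 'a" where
  "lie_bracket D a b = prelie D a b - prelie D b a"

definition brace :: "('a::comm_ring \<Rightarrow> 'a) \<Rightarrow> 'a list \<Rightarrow> 'a \<Rightarrow> 'a" where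
  "brace D as a = foldr (*) as ((D ^^ length as) a)"

text \<open>
  Lists form a monoid under concatenation, so \<open>'a list \<Rightarrow>\<^sub>0 rat\<close> with its convolution product is
  the free associative unital \<open>\<rat>\<close>-algebra on the set of letters \<open>'a\<close>.
\<close>

instantiation list :: (type) monoid_add
begin
definition zero_list_def: "0 = []"
definition plus_list_def: "xs + ys = xs @ ys"
instance by standard (simp_all add: zero_list_def plus_list_def)
end

definition free_alg :: "('a list \<Rightarrow>\<^sub>0 rat) ring" where
  "free_alg = ring_of_type_algebra"

definition word :: "'a list \<Rightarrow> 'a list \<Rightarrow>\<^sub>0 rat" where
  "word as = Poly_Mapping.single as 1"

definition scalar :: "rat \<Rightarrow> 'a list \<Rightarrow>\<^sub>0 rat" where
  "scalar q = Poly_Mapping.single [] q"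

text \<open>
  The tensor algebra of the vector space \<open>A\<close> arises from the free algebra on the underlying set
  of \<open>A\<close> by making the inclusion of letters linear.
\<close>

definition tensor_ideal :: "(rat \<Rightarrow> 'a::comm_ring \<Rightarrow> 'a) \<Rightarrow> ('a list \<Rightarrow>\<^sub>0 rat) set" where
  "tensor_ideal sc = Idl\<^bsub>free_alg\<^esub>
     (range (\<lambda>(a, b). word [a + b] - word [a] - word [b]) \<union>
      range (\<lambda>(q, a). word [sc q a] - scalar q * word [a]))"

definition tensor_alg :: "(rat \<Rightarrow> 'a::comm_ring \<Rightarrow> 'a) \<Rightarrow> ('a list \<Rightarrow>\<^sub>0 rat) set ring" where
  "tensor_alg sc = free_alg Quot tensor_ideal sc"

definition tensor_class ::
    "(rat \<Rightarrow> 'a::comm_ring \<Rightarrow> 'a) \<Rightarrow> ('a list \<Rightarrow>\<^sub>0 rat) \<Rightarrow> ('a list \<Rightarrow>\<^sub>0 rat) set" where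
  "tensor_class sc p = tensor_ideal sc +>\<^bsub>free_alg\<^esub> p"

definition tensor :: "(rat \<Rightarrow> 'a::comm_ring \<Rightarrow> 'a) \<Rightarrow> 'a list \<Rightarrow> ('a list \<Rightarrow>\<^sub>0 rat) set" where
  "tensor sc as = tensor_class sc (word as)"

definition env_ideal ::
    "(rat \<Rightarrow> 'a::comm_ring \<Rightarrow> 'a) \<Rightarrow> ('a \<Rightarrow> 'a) \<Rightarrow> ('a list \<Rightarrow>\<^sub>0 rat) set set" where
  "env_ideal sc D = Idl\<^bsub>tensor_alg sc\<^esub>
     (range (\<lambda>(a, b). tensor sc [a, b] \<ominus>\<^bsub>tensor_alg sc\<^esub> tensor sc [b, a]
        \<ominus>\<^bsub>tensor_alg sc\<^esub> tensor sc [lie_bracket D a b]))"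

definition env_alg ::
    "(rat \<Rightarrow> 'a::comm_ring \<Rightarrow> 'a) \<Rightarrow> ('a \<Rightarrow> 'a) \<Rightarrow> ('a list \<Rightarrow>\<^sub>0 rat) set set ring" where
  "env_alg sc D = tensor_alg sc Quot env_ideal sc D"

definition env_tensor ::
    "(rat \<Rightarrow> 'a::comm_ring \<Rightarrow> 'a) \<Rightarrow> ('a \<Rightarrow> 'a) \<Rightarrow> 'a list \<Rightarrow> ('a list \<Rightarrow>\<^sub>0 rat) set set" where
  "env_tensor sc D fs = env_ideal sc D +>\<^bsub>tensor_alg sc\<^esub> tensor sc fs"

definition sym_ideal :: "(rat \<Rightarrow> 'a::comm_ring \<Rightarrow> 'a) \<Rightarrow> ('a list \<Rightarrow>\<^sub>0 rat) set set" where
  "sym_ideal sc = Idl\<^bsub>tensor_alg sc\<^esub>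
     (range (\<lambda>(a, b). tensor sc [a, b] \<ominus>\<^bsub>tensor_alg sc\<^esub> tensor sc [b, a]))"

definition sym_alg :: "(rat \<Rightarrow> 'a::comm_ring \<Rightarrow> 'a) \<Rightarrow> ('a list \<Rightarrow>\<^sub>0 rat) set set ring" where
  "sym_alg sc = tensor_alg sc Quot sym_ideal sc"

definition sym_class ::
    "(rat \<Rightarrow> 'a::comm_ring \<Rightarrow> 'a) \<Rightarrow> ('a list \<Rightarrow>\<^sub>0 rat) \<Rightarrow> ('a list \<Rightarrow>\<^sub>0 rat) set set" where
  "sym_class sc p = sym_ideal sc +>\<^bsub>tensor_alg sc\<^esub> tensor_class sc p"

text \<open>
  An element \<open>S\<close> of \<^term>\<open>env_alg sc D\<close> or \<^term>\<open>sym_alg sc\<close> is a coset of cosets, so \<open>\<Union> S\<close> is the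
  set of all its representatives in the free algebra. Maps out of these quotients are defined
  below by applying \<^const>\<open>the_elem\<close> to the set of values on all representatives.
\<close>

text \<open>
  Ordered decompositions of \<open>[m]\<close> into \<open>n + 1\<close> possibly empty blocks correspond to maps \<open>g\<close> sending
  an index to the number of its block. Indices and blocks are counted from \<open>0\<close>, so block \<open>j < n\<close>
  is put on the \<open>j\<close>-th factor \<open>ws ! j\<close>, and block \<open>n\<close> is the block that is left over.
\<close>

definition block :: "'a list \<Rightarrow> (nat \<Rightarrow> nat) \<Rightarrow> nat \<Rightarrow> 'a list" where
  "block zs g j = map ((!) zs) (filter (\<lambda>i. g i = j) [0..<length zs])"

definition star_words ::
    "('a::comm_ring \<Rightarrow> 'a) \<Rightarrow> 'a list \<Rightarrow> 'a list \<Rightarrow> 'a list \<Rightarrow>\<^sub>0 rat" where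
  "star_words D zs ws =
     (\<Sum>g \<in> {..<length zs} \<rightarrow>\<^sub>E {..length ws}.
        word (map (\<lambda>j. brace D (block zs g j) (ws ! j)) [0..<length ws] @ block zs g (length ws)))"

definition star_free ::
    "('a::comm_ring \<Rightarrow> 'a) \<Rightarrow> ('a list \<Rightarrow>\<^sub>0 rat) \<Rightarrow> ('a list \<Rightarrow>\<^sub>0 rat) \<Rightarrow> 'a list \<Rightarrow>\<^sub>0 rat" where
  "star_free D p q =
     (\<Sum>zs \<in> Poly_Mapping.keys p. \<Sum>ws \<in> Poly_Mapping.keys q.
        scalar (Poly_Mapping.lookup p zs * Poly_Mapping.lookup q ws) * star_words D zs ws)"

definition star ::
    "(rat \<Rightarrow> 'a::comm_ring \<Rightarrow> 'a) \<Rightarrow> ('a \<Rightarrow> 'a) \<Rightarrow>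
     ('a list \<Rightarrow>\<^sub>0 rat) set set \<Rightarrow> ('a list \<Rightarrow>\<^sub>0 rat) set set \<Rightarrow> ('a list \<Rightarrow>\<^sub>0 rat) set set" where
  "star sc D S T = the_elem {sym_class sc (star_free D p q) | p q. p \<in> \<Union> S \<and> q \<in> \<Union> T}"

text \<open>
  This is \<open>f\<^sub>1 *\<^sup>o\<^sup>p \<dots> *\<^sup>o\<^sup>p f\<^sub>i\<close>, bracketed to the right; the unit of \<open>\<rat>[A]\<close> is also the unit of
  \<open>*\<^sup>o\<^sup>p\<close>. It is extended linearly to \<open>U(A)\<close> in \<open>env_to_sym\<close>.
\<close>

definition star_list ::
    "(rat \<Rightarrow> 'a::comm_ring \<Rightarrow> 'a) \<Rightarrow> ('a \<Rightarrow> 'a) \<Rightarrow> 'a list \<Rightarrow> ('a list \<Rightarrow>\<^sub>0 rat) set set" where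
  "star_list sc D fs =
     foldr (\<lambda>f S. star sc D (sym_class sc (word [f])) S) fs \<one>\<^bsub>sym_alg sc\<^esub>"

definition env_to_sym ::
    "(rat \<Rightarrow> 'a::comm_ring \<Rightarrow> 'a) \<Rightarrow> ('a \<Rightarrow> 'a) \<Rightarrow>
     ('a list \<Rightarrow>\<^sub>0 rat) set set \<Rightarrow> ('a list \<Rightarrow>\<^sub>0 rat) set set" where
  "env_to_sym sc D u = the_elem
     ((\<lambda>p. \<Oplus>\<^bsub>sym_alg sc\<^esub>fs \<in> Poly_Mapping.keys p.
          sym_class sc (scalar (Poly_Mapping.lookup p fs)) \<otimes>\<^bsub>sym_alg sc\<^esub> star_list sc D fs) ` \<Union> u)"

definition degree_one :: "(rat \<Rightarrow> 'a::comm_ring \<Rightarrow> 'a) \<Rightarrow> ('a list \<Rightarrow>\<^sub>0 rat) set set \<Rightarrow> 'a" where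
  "degree_one sc S = the_elem
     ((\<lambda>p. \<Sum>as \<in> {as \<in> Poly_Mapping.keys p. length as = 1}.
          sc (Poly_Mapping.lookup p as) (hd as)) ` \<Union> S)"

definition eta ::
    "(rat \<Rightarrow> 'a::comm_ring \<Rightarrow> 'a) \<Rightarrow> ('a \<Rightarrow> 'a) \<Rightarrow> ('a list \<Rightarrow>\<^sub>0 rat) set set \<Rightarrow> 'a" where
  "eta sc D u = degree_one sc (env_to_sym sc D u)"

definition K :: "nat \<Rightarrow> nat list set" where
  "K i = {w. length w = i \<and> (\<forall>j. 1 \<le> j \<and> j < i \<longrightarrow> sum_list (take j w) \<le> j - 1) \<and>
             sum_list w = i - 1}"

text \<open>
  The letter \<open>w\<^sub>j\<close> is \<open>w ! (j - 1)\<close>. For \<open>w \<in> K i\<close> and \<open>1 \<le> j \<le> i\<close> the subtractions do not truncate.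
\<close>

definition height :: "nat list \<Rightarrow> nat \<Rightarrow> nat" where
  "height w j = j - 1 - sum_list (take j w)"

definition coeff_K :: "nat list \<Rightarrow> nat" where
  "coeff_K w = (\<Prod>j = 1..length w. (height w j + w ! (j - 1)) choose (w ! (j - 1)))"

text \<open>There may be no unit, so only products of non-empty lists are meaningful.\<close>

fun mult_list :: "'a::comm_ring list \<Rightarrow> 'a" where
  "mult_list [] = 0"
| "mult_list [a] = a"
| "mult_list (a # b # as) = a * mult_list (b # as)"

end

theory Submission
  imports Defs
begin

text \<open>
  All quotients are handled on representatives: a coset of cosets is a coset of the two-sided ideal
  of the free algebra generated by both sets of relations, so each map defined by \<^const>\<open>the_elem\<close>
  reduces to the claim that an additive map sends the elements \<open>u g v\<close>, with \<open>u\<close>, \<open>v\<close> words and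
  \<open>g\<close> a relation, into the target ideal.

  Left \<open>*\<^sup>o\<^sup>p\<close>-multiplication by a letter \<open>f\<close> is \<open>p \<mapsto> X\<^sub>f p + p f\<close>, where \<open>X\<^sub>f\<close> is the derivation
  extending \<open>a \<mapsto> f \<triangleright> a\<close>. As \<open>[X\<^sub>a, X\<^sub>b]\<close> and \<open>X\<^bsub>[a, b]\<^esub>\<close> agree on letters, these operators satisfy the
  relations of \<open>U(A)\<close>, and in degree one they give \<open>f\<^sub>1 \<triangleright> (f\<^sub>2 \<triangleright> \<dots>)\<close>. Reading the factors from the
  left, \<open>d\<^sub>j + w\<^sub>j\<close> copies of \<open>\<partial>\<close> arrive at \<open>f\<^sub>j\<close>, and the Leibniz rule chooses the \<open>w\<^sub>j\<close> of them that act on it.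
\<close>

section \<open>Two-sided ideals and iterated quotients\<close>

text \<open>Closure under negation is not a rule because a sign can be absorbed into
  \<open>x\<close>. The inductive form supplies the induction over generators used for every map out
  of a quotient.\<close>

inductive_set gen_ideal :: "'b::ring_1 set \<Rightarrow> 'b set" for G where
  gen_ideal_zero: "0 \<in> gen_ideal G"
| gen_ideal_add: "p \<in> gen_ideal G \<Longrightarrow> q \<in> gen_ideal G \<Longrightarrow> p + q \<in> gen_ideal G"
| gen_ideal_gen: "g \<in> G \<Longrightarrow> x * g * y \<in> gen_ideal G"

lemma gen_ideal_mult_left: "p \<in> gen_ideal G \<Longrightarrow> a * p \<in> gen_ideal G"
proof (induction rule: gen_ideal.induct)
  case (gen_ideal_gen g x y)
  then show ?case using gen_ideal.gen_ideal_gen[of g G "a * x" y] by (simp add: mult.assoc)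
qed (auto simp: distrib_left intro: gen_ideal.intros)

lemma gen_ideal_mult_right: "p \<in> gen_ideal G \<Longrightarrow> p * a \<in> gen_ideal G"
proof (induction rule: gen_ideal.induct)
  case (gen_ideal_gen g x y)
  then show ?case using gen_ideal.gen_ideal_gen[of g G x "y * a"] by (simp add: mult.assoc)
qed (auto simp: distrib_right intro: gen_ideal.intros)

lemma gen_ideal_uminus: "p \<in> gen_ideal G \<Longrightarrow> - p \<in> gen_ideal G"
  using gen_ideal_mult_left[of p G "- 1"] by simp

lemma gen_ideal_diff: "p \<in> gen_ideal G \<Longrightarrow> q \<in> gen_ideal G \<Longrightarrow> p - q \<in> gen_ideal G"
  using gen_ideal_add[OF _ gen_ideal_uminus, of p G q] by simp

lemma gen_ideal_base: "g \<in> G \<Longrightarrow> g \<in> gen_ideal G"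
  using gen_ideal_gen[of g G 1 1] by simp

lemma gen_ideal_mono: "G \<subseteq> H \<Longrightarrow> gen_ideal G \<subseteq> gen_ideal H"
proof
  fix p assume "G \<subseteq> H" "p \<in> gen_ideal G"
  from this(2) show "p \<in> gen_ideal H"
    using \<open>G \<subseteq> H\<close> by induction (auto intro: gen_ideal.intros)
qed

section \<open>Rings on a whole type\<close>

lemma ring_of_type_algebra_simps [simp]:
  "carrier ring_of_type_algebra = UNIV"
  "x \<otimes>\<^bsub>ring_of_type_algebra\<^esub> y = x * y"
  "x \<oplus>\<^bsub>ring_of_type_algebra\<^esub> y = x + y"
  "\<one>\<^bsub>ring_of_type_algebra\<^esub> = 1"
  "\<zero>\<^bsub>ring_of_type_algebra\<^esub> = 0"
  by (simp_all add: ring_of_type_algebra_def)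

lemma ring_ring_of_type_algebra: "ring (ring_of_type_algebra :: 'b::ring_1 ring)"
proof -
  have "\<exists>y. x + y = 0 \<and> y + x = 0" for x :: 'b
    by (rule exI[of _ "- x"]) simp
  then show ?thesis
    by unfold_locales (auto simp: algebra_simps Units_def)
qed

lemma uminus_ring_of_type_algebra [simp]:
  "\<ominus>\<^bsub>ring_of_type_algebra\<^esub> x = - (x :: 'b::ring_1)"
proof -
  interpret ring "ring_of_type_algebra :: 'b ring" by (rule ring_ring_of_type_algebra)
  show ?thesis using minus_equality[of "- x" x] by simp
qed

lemma minus_ring_of_type_algebra [simp]:
  "x \<ominus>\<^bsub>ring_of_type_algebra\<^esub> y = x - (y :: 'b::ring_1)"
  by (simp add: a_minus_def)

lemma ideal_gen_ideal: "ideal (gen_ideal G) (ring_of_type_algebra :: 'b::ring_1 ring)"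
proof -
  interpret ring "ring_of_type_algebra :: 'b ring" by (rule ring_ring_of_type_algebra)
  show ?thesis
  proof (rule idealI[OF ring_ring_of_type_algebra])
    show "subgroup (gen_ideal G) (add_monoid (ring_of_type_algebra :: 'b ring))"
    proof (rule add.subgroupI)
      show "gen_ideal G \<noteq> {}" using gen_ideal_zero by auto
      show "\<ominus>\<^bsub>ring_of_type_algebra\<^esub> a \<in> gen_ideal G" if "a \<in> gen_ideal G" for a
        using that by (simp add: gen_ideal_uminus)
    qed (auto intro: gen_ideal_add)
  qed (auto intro: gen_ideal_mult_left gen_ideal_mult_right)
qed

lemma genideal_eq_gen_ideal:
  "Idl\<^bsub>ring_of_type_algebra\<^esub> G = gen_ideal (G :: 'b::ring_1 set)"
proof -
  interpret R: ring "ring_of_type_algebra :: 'b ring" by (rule ring_ring_of_type_algebra)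
  interpret I: ideal "Idl\<^bsub>ring_of_type_algebra\<^esub> G" ring_of_type_algebra
    by (rule R.genideal_ideal) simp
  show ?thesis
  proof
    show "Idl\<^bsub>ring_of_type_algebra\<^esub> G \<subseteq> gen_ideal G"
      by (rule R.genideal_minimal[OF ideal_gen_ideal]) (auto intro: gen_ideal_base)
    show "gen_ideal G \<subseteq> Idl\<^bsub>ring_of_type_algebra\<^esub> G"
    proof
      fix p assume "p \<in> gen_ideal G"
      then show "p \<in> Idl\<^bsub>ring_of_type_algebra\<^esub> G"
      proof induction
        case gen_ideal_zero
        show ?case using I.zero_closed by simp
      next
        case (gen_ideal_add p q)
        then show ?case using I.a_closed[of p q] by simp
      next
        case (gen_ideal_gen g x y)
        have "g \<in> Idl\<^bsub>ring_of_type_algebra\<^esub> G"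
          using R.genideal_self[of G] gen_ideal_gen by auto
        then show ?case
          using I.I_l_closed[of g x] I.I_r_closed[of "x * g" y] by simp
      qed
    qed
  qed
qed

section \<open>Quotients by one and by two sets of relations\<close>

definition quot1 :: "'b::ring_1 set \<Rightarrow> 'b \<Rightarrow> 'b set" where
  "quot1 G p = Idl\<^bsub>ring_of_type_algebra\<^esub> G +>\<^bsub>ring_of_type_algebra\<^esub> p"

definition quot1_ring :: "'b::ring_1 set \<Rightarrow> 'b set ring" where
  "quot1_ring G = ring_of_type_algebra Quot (Idl\<^bsub>ring_of_type_algebra\<^esub> G)"

text \<open>The class of \<open>p\<close> after dividing by \<open>G\<close> and then by the image
  of \<open>H\<close>. The enveloping and the symmetric algebra both have this form, with the tensor
  relations as \<open>G\<close>.\<close>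

definition quot2 :: "'b::ring_1 set \<Rightarrow> 'b set \<Rightarrow> 'b \<Rightarrow> 'b set set" where
  "quot2 G H p = Idl\<^bsub>quot1_ring G\<^esub> (quot1 G ` H) +>\<^bsub>quot1_ring G\<^esub> quot1 G p"

definition quot2_ring :: "'b::ring_1 set \<Rightarrow> 'b set \<Rightarrow> 'b set set ring" where
  "quot2_ring G H = quot1_ring G Quot (Idl\<^bsub>quot1_ring G\<^esub> (quot1 G ` H))"

lemma quot1_hom: "ring_hom_ring ring_of_type_algebra (quot1_ring G) (quot1 G)"
proof -
  interpret I: ideal "gen_ideal G" "ring_of_type_algebra" by (rule ideal_gen_ideal)
  show ?thesis
    using I.rcos_ring_hom_ring
    by (simp add: quot1_ring_def quot1_def[abs_def] genideal_eq_gen_ideal)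
qed

lemma mem_quot1: "q \<in> quot1 G p \<longleftrightarrow> q - p \<in> gen_ideal G"
proof -
  have "q \<in> quot1 G p \<longleftrightarrow> (\<exists>h \<in> gen_ideal G. q = h + p)"
    unfolding quot1_def genideal_eq_gen_ideal a_r_coset_def' by simp
  also have "\<dots> \<longleftrightarrow> q - p \<in> gen_ideal G"
    by (metis add_diff_cancel_right' diff_add_cancel)
  finally show ?thesis .
qed

lemma quot1_eq_iff: "quot1 G p = quot1 G q \<longleftrightarrow> p - q \<in> gen_ideal G"
proof -
  interpret ring "ring_of_type_algebra :: 'a ring" by (rule ring_ring_of_type_algebra)
  show ?thesis
    using quotient_eq_iff_same_a_r_cos[OF ideal_gen_ideal, of p q G]
    by (simp add: quot1_def genideal_eq_gen_ideal)
qed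

lemma carrier_quot1_ring: "carrier (quot1_ring G) = range (quot1 G)"
  unfolding quot1_ring_def quot1_def[abs_def] FactRing_def A_RCOSETS_def'
  by auto

text \<open>This is the third isomorphism theorem on the level of generators. The image of
  \<open>gen_ideal (G \<union> H)\<close> is an ideal containing the image of \<open>H\<close>, and
  lifting from the quotient costs only an element of \<open>gen_ideal G\<close>. The converse is an
  induction over generators.\<close>

lemma quot1_mem_genideal_iff:
  "quot1 G p \<in> Idl\<^bsub>quot1_ring G\<^esub> (quot1 G ` H) \<longleftrightarrow> p \<in> gen_ideal (G \<union> H)"
proof -
  interpret h: ring_hom_ring ring_of_type_algebra "quot1_ring G" "quot1 G" by (rule quot1_hom)
  have GH: "quot1 G ` H \<subseteq> carrier (quot1_ring G)" by (auto simp: carrier_quot1_ring)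
  interpret I: ideal "Idl\<^bsub>quot1_ring G\<^esub> (quot1 G ` H)" "quot1_ring G"
    by (rule h.S.genideal_ideal[OF GH])
  have image_ideal: "ideal (quot1 G ` gen_ideal (G \<union> H)) (quot1_ring G)"
    using h.R.ring_ideal_imp_quot_ideal[OF ideal_gen_ideal ideal_gen_ideal, of G "G \<union> H"]
    by (simp add: quot1_ring_def quot1_def[abs_def] genideal_eq_gen_ideal)
  show ?thesis
  proof
    assume "quot1 G p \<in> Idl\<^bsub>quot1_ring G\<^esub> (quot1 G ` H)"
    moreover have "quot1 G ` H \<subseteq> quot1 G ` gen_ideal (G \<union> H)"
      by (intro image_mono) (auto intro: gen_ideal_base)
    ultimately obtain q where q: "q \<in> gen_ideal (G \<union> H)" "quot1 G p = quot1 G q"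
      using h.S.genideal_minimal[OF image_ideal] by blast
    then have "p - q \<in> gen_ideal (G \<union> H)"
      using gen_ideal_mono[of G "G \<union> H"] by (auto simp: quot1_eq_iff)
    from gen_ideal_add[OF this q(1)] show "p \<in> gen_ideal (G \<union> H)" by simp
  next
    assume "p \<in> gen_ideal (G \<union> H)"
    then show "quot1 G p \<in> Idl\<^bsub>quot1_ring G\<^esub> (quot1 G ` H)"
    proof induction
      case gen_ideal_zero
      show ?case using I.zero_closed h.hom_zero by simp
    next
      case (gen_ideal_add p q)
      then show ?case using I.a_closed h.hom_add[of p q] by simp
    next
      case (gen_ideal_gen g x y)
      have "quot1 G g \<in> Idl\<^bsub>quot1_ring G\<^esub> (quot1 G ` H)"
      proof (cases "g \<in> H")
        case True
        then show ?thesis using h.S.genideal_self[OF GH] by auto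
      next
        \<comment> \<open>Such a generator lies in \<open>G\<close>, so its class is already zero in
          the first quotient.\<close>
        case False
        then have "quot1 G g = quot1 G 0"
          using gen_ideal_gen by (simp add: quot1_eq_iff gen_ideal_base)
        then show ?thesis using I.zero_closed h.hom_zero by simp
      qed
      then show ?case
        using I.I_l_closed[of "quot1 G g" "quot1 G x"]
          I.I_r_closed[of "quot1 G (x * g)" "quot1 G y"]
          h.hom_mult[of x g] h.hom_mult[of "x * g" y]
        by (simp add: carrier_quot1_ring)
    qed
  qed
qed

lemma quot1_minus: "quot1 G p \<ominus>\<^bsub>quot1_ring G\<^esub> quot1 G q = quot1 G (p - q)"
proof -
  interpret h: ring_hom_ring ring_of_type_algebra "quot1_ring G" "quot1 G" by (rule quot1_hom)
  show ?thesis
    using h.hom_add[of p "- q"] h.hom_a_inv[of q] by (simp add: a_minus_def)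
qed

lemma quot2_eq_iff: "quot2 G H p = quot2 G H q \<longleftrightarrow> p - q \<in> gen_ideal (G \<union> H)"
proof -
  interpret h: ring_hom_ring ring_of_type_algebra "quot1_ring G" "quot1 G" by (rule quot1_hom)
  have I: "ideal (Idl\<^bsub>quot1_ring G\<^esub> (quot1 G ` H)) (quot1_ring G)"
    by (rule h.S.genideal_ideal) (auto simp: carrier_quot1_ring)
  show ?thesis
    using h.S.quotient_eq_iff_same_a_r_cos[OF I, of "quot1 G p" "quot1 G q"]
    by (simp add: quot1_minus quot2_def quot1_mem_genideal_iff carrier_quot1_ring)
qed

text \<open>All representatives of a coset of cosets form one coset of
  \<open>gen_ideal (G \<union> H)\<close>. Well-definedness of the maps given by
  \<open>the_elem\<close> thus becomes invariance modulo this ideal.\<close>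

lemma Union_quot2: "\<Union> (quot2 G H p) = {q. q - p \<in> gen_ideal (G \<union> H)}"
proof -
  interpret h: ring_hom_ring ring_of_type_algebra "quot1_ring G" "quot1 G" by (rule quot1_hom)
  interpret I: ideal "Idl\<^bsub>quot1_ring G\<^esub> (quot1 G ` H)" "quot1_ring G"
    by (rule h.S.genideal_ideal) (auto simp: carrier_quot1_ring)
  have mem: "quot1 G q \<in> quot2 G H p \<longleftrightarrow> q - p \<in> gen_ideal (G \<union> H)" for q
  proof -
    have "quot1 G q \<in> quot2 G H p \<longleftrightarrow> quot2 G H p = quot2 G H q"
      using I.a_rcos_self[of "quot1 G q"] I.a_repr_independence'[of "quot1 G q" "quot1 G p"]
      by (auto simp: quot2_def carrier_quot1_ring)
    then show ?thesis
      using quot2_eq_iff[of G H q p] by auto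
  qed
  have sub: "quot2 G H p \<subseteq> range (quot1 G)"
    using I.a_elemrcos_carrier[of "quot1 G p"]
    by (auto simp: quot2_def carrier_quot1_ring)
  have "q \<in> \<Union> (quot2 G H p) \<longleftrightarrow> quot1 G q \<in> quot2 G H p" for q
  proof
    assume "q \<in> \<Union> (quot2 G H p)"
    then obtain S where "S \<in> quot2 G H p" "q \<in> S" by blast
    moreover from this sub obtain s where "S = quot1 G s" by blast
    ultimately show "quot1 G q \<in> quot2 G H p"
      using quot1_eq_iff[of G q s] mem_quot1[of q G s] by simp
  next
    assume "quot1 G q \<in> quot2 G H p"
    moreover have "q \<in> quot1 G q" by (simp add: mem_quot1 gen_ideal_zero)
    ultimately show "q \<in> \<Union> (quot2 G H p)" by blast
  qed
  with mem show ?thesis by auto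
qed

lemma quot2_hom: "ring_hom_ring ring_of_type_algebra (quot2_ring G H) (quot2 G H)"
proof -
  interpret h: ring_hom_ring ring_of_type_algebra "quot1_ring G" "quot1 G" by (rule quot1_hom)
  interpret I: ideal "Idl\<^bsub>quot1_ring G\<^esub> (quot1 G ` H)" "quot1_ring G"
    by (rule h.S.genideal_ideal) (auto simp: carrier_quot1_ring)
  have "quot2 G H \<in> ring_hom ring_of_type_algebra (quot2_ring G H)"
    using ring_hom_trans[OF h.homh I.rcos_ring_hom]
    by (simp add: quot2_ring_def quot2_def[abs_def] comp_def)
  then show ?thesis
    unfolding quot2_ring_def
    by (intro ring_hom_ringI2 ring_ring_of_type_algebra I.quotient_is_ring)
qed

lemma finsum_quot2:
  "(\<Oplus>\<^bsub>quot2_ring G H\<^esub>i \<in> I. quot2 G H (f i)) = quot2 G H (sum f I)" if "finite I"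
proof -
  interpret h: ring_hom_ring ring_of_type_algebra "quot2_ring G H" "quot2 G H" by (rule quot2_hom)
  have carr: "quot2 G H p \<in> carrier (quot2_ring G H)" for p
    using h.hom_closed[of p] by simp
  have add: "quot2 G H p \<oplus>\<^bsub>quot2_ring G H\<^esub> quot2 G H q = quot2 G H (p + q)" for p q
    using h.hom_add[of p q] by simp
  show ?thesis
    using that
  proof induction
    case empty
    then show ?case using h.hom_zero by simp
  next
    case (insert i I)
    then show ?case by (simp add: carr add)
  qed
qed

section \<open>The free algebra\<close>

lemma word_append: "word (u @ v) = word u * word v"
  by (simp add: word_def mult_single plus_list_def)

lemma word_Cons: "word (a # u) = word [a] * word u"
  using word_append[of "[a]" u] by simp

lemma word_Nil: "word [] = 1"
  by (simp add: word_def zero_list_def[symmetric])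

lemma scalar_word: "scalar c * word u = Poly_Mapping.single u c"
  by (simp add: word_def scalar_def mult_single plus_list_def)

lemma scalar_add: "scalar (c + d) = scalar c + scalar d"
  by (simp add: scalar_def single_add)

lemma scalar_zero: "scalar 0 = 0"
  by (simp add: scalar_def)

lemma scalar_one: "scalar 1 = 1"
  by (simp add: scalar_def zero_list_def[symmetric])

lemma scalar_mult: "scalar (c * d) = scalar c * scalar d"
  by (simp add: scalar_def mult_single plus_list_def)

section \<open>Linear extension from words\<close>

definition lin_ext :: "('a list \<Rightarrow> 'a list \<Rightarrow>\<^sub>0 rat) \<Rightarrow> ('a list \<Rightarrow>\<^sub>0 rat) \<Rightarrow> 'a list \<Rightarrow>\<^sub>0 rat" where
  "lin_ext F p = (\<Sum>u \<in> Poly_Mapping.keys p. scalar (Poly_Mapping.lookup p u) * F u)"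

lemma lin_ext_word_id: "lin_ext word p = p"
proof (rule poly_mapping_eqI)
  fix v
  have "Poly_Mapping.lookup (lin_ext word p) v =
      (\<Sum>u \<in> Poly_Mapping.keys p. Poly_Mapping.lookup p u when u = v)"
    by (simp add: lin_ext_def scalar_word lookup_sum lookup_single)
  also have "\<dots> = Poly_Mapping.lookup p v"
    by (simp add: when_def sum.delta' in_keys_iff)
  finally show "Poly_Mapping.lookup (lin_ext word p) v = Poly_Mapping.lookup p v" .
qed

text \<open>Words span the free algebra, by \<open>lin_ext_word_id\<close>, so additive properties
  need only be checked on multiples of words.\<close>

lemma free_alg_induct [case_names zero add word]:
  assumes "P 0" "\<And>p q. P p \<Longrightarrow> P q \<Longrightarrow> P (p + q)" "\<And>c u. P (scalar c * word u)"
  shows "P p"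
proof -
  have "P (\<Sum>u \<in> I. scalar (Poly_Mapping.lookup p u) * word u)" if "finite I" for I
    using that by induction (auto intro: assms)
  from this[of "Poly_Mapping.keys p"] show ?thesis
    using lin_ext_word_id[of p] by (simp add: lin_ext_def)
qed

lemma scalar_commute: "p * scalar c = scalar c * p"
proof (induction p rule: free_alg_induct)
  case (word d u)
  show ?case
    unfolding scalar_word
    by (simp add: scalar_def mult_single plus_list_def mult.commute)
qed (simp_all add: algebra_simps)

lemma mult_scalar_left: "p * (scalar c * q) = scalar c * (p * q)"
  by (metis mult.assoc scalar_commute)

lemma lin_ext_add: "lin_ext F (p + q) = lin_ext F p + lin_ext F q"
  unfolding lin_ext_def
  by (rule setsum_keys_plus_distrib) (simp_all add: scalar_zero scalar_add distrib_right)

lemma lin_ext_zero: "lin_ext F 0 = 0"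
  by (simp add: lin_ext_def)

lemma lin_ext_single: "lin_ext F (Poly_Mapping.single u c) = scalar c * F u"
  by (simp add: lin_ext_def scalar_zero)

lemma lin_ext_word: "lin_ext F (word u) = F u"
  by (simp add: word_def lin_ext_single scalar_one)

lemma lin_ext_scalar: "lin_ext F (scalar c * p) = scalar c * lin_ext F p"
proof (induction p rule: free_alg_induct)
  case (word d u)
  have "scalar c * (scalar d * word u) = Poly_Mapping.single u (c * d)"
    by (metis mult.assoc scalar_mult scalar_word)
  then show ?case by (simp add: lin_ext_single scalar_word scalar_mult mult.assoc)
qed (simp_all add: lin_ext_zero lin_ext_add distrib_left)

lemma lin_ext_uminus: "lin_ext F (- p) = - lin_ext F p"
  using lin_ext_add[of F p "- p"] by (simp add: lin_ext_zero eq_neg_iff_add_eq_0 add.commute)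

lemma lin_ext_diff: "lin_ext F (p - q) = lin_ext F p - lin_ext F q"
  using lin_ext_add[of F p "- q"] by (simp add: lin_ext_uminus)

text \<open>Expand both cofactors of a generator into words and collect their scalars, which are
  central, in front. The factor \<open>c\<close> remains in the hypothesis because
  \<open>\<phi>\<close> is only additive.\<close>

lemma additive_on_gen_ideal:
  fixes \<phi> :: "('a list \<Rightarrow>\<^sub>0 rat) \<Rightarrow> 'b::ab_group_add"
  assumes p: "p \<in> gen_ideal G"
    and add: "\<And>p q. \<phi> (p + q) = \<phi> p + \<phi> q"
    and Z: "0 \<in> Z" "\<And>x y. x \<in> Z \<Longrightarrow> y \<in> Z \<Longrightarrow> x + y \<in> Z"
    and gen: "\<And>g c u v. g \<in> G \<Longrightarrow> \<phi> (scalar c * (word u * g * word v)) \<in> Z"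
  shows "\<phi> p \<in> Z"
  using p
proof induction
  have "\<phi> 0 = 0" using add[of 0 0] by simp
  then show zero: "\<phi> 0 \<in> Z" using Z by simp
  show "\<phi> (p + q) \<in> Z" if "\<phi> p \<in> Z" "\<phi> q \<in> Z" for p q
    using that by (simp add: add Z)
  show "\<phi> (x * g * y) \<in> Z" if g: "g \<in> G" for g x y
  proof (induction x rule: free_alg_induct)
    case (word c u)
    show ?case
    proof (induction y rule: free_alg_induct)
      case (word d v)
      have "scalar c * word u * g * (scalar d * word v) = scalar d * (scalar c * word u * g * word v)"
        by (rule mult_scalar_left)
      also have "\<dots> = scalar (d * c) * (word u * g * word v)"
        by (simp only: scalar_mult mult.assoc)
      finally show ?case using gen[OF g, of "d * c"] by simp
    qed (simp_all add: zero add Z distrib_left)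
  qed (simp_all add: zero add Z distrib_right)
qed

section \<open>Constant terms, read off at the empty word\<close>

lemma lookup_Nil_Cons: "Poly_Mapping.lookup (word (a # u)) [] = 0"
  by (simp add: word_def lookup_single)

lemma lookup_Nil_word: "Poly_Mapping.lookup (word u) [] = (if u = [] then 1 else 0)"
  by (simp add: word_def lookup_single)

lemma lookup_Nil_scalar: "Poly_Mapping.lookup (scalar c * p) [] = c * Poly_Mapping.lookup p []"
proof (induction p rule: free_alg_induct)
  case (word d u)
  have "scalar c * (scalar d * word u) = Poly_Mapping.single u (c * d)"
    by (metis mult.assoc scalar_mult scalar_word)
  then show ?case by (simp add: scalar_word lookup_single when_def)
qed (simp_all add: distrib_left lookup_add)

lemma lookup_Nil_mult_letter: "Poly_Mapping.lookup (p * word [a]) [] = 0"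
proof (induction p rule: free_alg_induct)
  case (word c u)
  show ?case
    by (cases u) (simp_all add: mult.assoc word_append[symmetric] lookup_Nil_scalar lookup_Nil_Cons)
qed (simp_all add: distrib_right lookup_add)

lemma lookup_Nil_letter_mult: "Poly_Mapping.lookup (word [a] * p) [] = 0"
proof (induction p rule: free_alg_induct)
  case (word c u)
  show ?case
    by (simp add: mult_scalar_left word_append[symmetric] lookup_Nil_scalar lookup_Nil_Cons)
qed (simp_all add: distrib_left lookup_add)

section \<open>Distributing letters over blocks\<close>

text \<open>The sum over all distributions of the letters over the blocks \<open>0\<close> to
  \<open>n\<close>, as a recursion that allows induction on the list. Each letter goes in front of
  those that follow it, so blocks keep the order of the list.\<close>

fun dist_sum :: "nat \<Rightarrow> ((nat \<Rightarrow> 'a list) \<Rightarrow> 'b::comm_monoid_add) \<Rightarrow> 'a list \<Rightarrow> 'b" where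
  "dist_sum n F [] = F (\<lambda>_. [])"
| "dist_sum n F (z # zs) = (\<Sum>k\<le>n. dist_sum n (\<lambda>\<beta>. F (\<beta>(k := z # \<beta> k))) zs)"

text \<open>The function \<open>case_nat k g\<close> places the first letter in block
  \<open>k\<close> and leaves the remaining letters, with indices shifted by one, to
  \<open>g\<close>.\<close>

lemma block_Cons:
  "block (z # zs) (case_nat k g) = (block zs g)(k := z # block zs g k)"
proof
  fix j
  have "[0..<length (z # zs)] = 0 # map Suc [0..<length zs]"
    by (simp add: upt_conv_Cons map_Suc_upt del: upt_Suc)
  then have "filter (\<lambda>i. case_nat k g i = j) [0..<length (z # zs)] =
      (if k = j then [0] else []) @ map Suc (filter (\<lambda>i. g i = j) [0..<length zs])"
    by (simp add: filter_map comp_def)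
  then show "block (z # zs) (case_nat k g) j = ((block zs g)(k := z # block zs g k)) j"
    by (simp add: block_def comp_def)
qed

lemma bij_betw_case_nat:
  "bij_betw (\<lambda>(k, g). case_nat k g) (A \<times> ({..<m} \<rightarrow>\<^sub>E A)) ({..<Suc m} \<rightarrow>\<^sub>E A)"
proof (rule bij_betwI[where g = "\<lambda>h. (h 0, \<lambda>i. h (Suc i))"])
  show "(\<lambda>(k, g). case_nat k g) \<in> A \<times> ({..<m} \<rightarrow>\<^sub>E A) \<rightarrow> ({..<Suc m} \<rightarrow>\<^sub>E A)"
  proof (rule funcsetI)
    fix x assume "x \<in> A \<times> ({..<m} \<rightarrow>\<^sub>E A)"
    then obtain k g where x: "x = (k, g)" and k: "k \<in> A" and g: "g \<in> {..<m} \<rightarrow>\<^sub>E A"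
      by (rule SigmaE)
    have "case_nat k g \<in> {..<Suc m} \<rightarrow>\<^sub>E A"
    proof (rule PiE_I)
      show "case_nat k g i \<in> A" if "i \<in> {..<Suc m}" for i
        using that k g by (cases i) auto
      show "case_nat k g i = undefined" if "i \<notin> {..<Suc m}" for i
        using that g by (cases i) (auto intro: PiE_arb)
    qed
    then show "(\<lambda>(k, g). case_nat k g) x \<in> {..<Suc m} \<rightarrow>\<^sub>E A"
      by (simp add: x)
  qed
  show "(\<lambda>h. (h 0, \<lambda>i. h (Suc i))) \<in> ({..<Suc m} \<rightarrow>\<^sub>E A) \<rightarrow> A \<times> ({..<m} \<rightarrow>\<^sub>E A)"
  proof (rule funcsetI)
    fix h assume h: "h \<in> {..<Suc m} \<rightarrow>\<^sub>E A"
    show "(h 0, \<lambda>i. h (Suc i)) \<in> A \<times> ({..<m} \<rightarrow>\<^sub>E A)"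
    proof (intro SigmaI PiE_I)
      show "h 0 \<in> A" using PiE_mem[OF h, of 0] by simp
      show "h (Suc i) \<in> A" if "i \<in> {..<m}" for i
        using that PiE_mem[OF h, of "Suc i"] by simp
      show "h (Suc i) = undefined" if "i \<notin> {..<m}" for i
        using that PiE_arb[OF h, of "Suc i"] by simp
    qed
  qed
  show "(\<lambda>h. (h 0, \<lambda>i. h (Suc i))) ((\<lambda>(k, g). case_nat k g) x) = x" for x :: "'a \<times> (nat \<Rightarrow> 'a)"
    by (cases x) simp
  show "(\<lambda>(k, g). case_nat k g) ((\<lambda>h. (h 0, \<lambda>i. h (Suc i))) h) = h" for h :: "nat \<Rightarrow> 'a"
    by (rule ext) (simp split: nat.split)
qed

lemma sum_blocks:
  "(\<Sum>g \<in> {..<length zs} \<rightarrow>\<^sub>E {..n}. F (block zs g)) = dist_sum n F zs"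
  for zs :: "'a list"
proof (induction zs arbitrary: F)
  case Nil
  have "block ([] :: 'a list) g = (\<lambda>_. [])" for g :: "nat \<Rightarrow> nat"
    by (simp add: block_def fun_eq_iff)
  then show ?case by simp
next
  case (Cons z zs)
  have "(\<Sum>g \<in> {..<length (z # zs)} \<rightarrow>\<^sub>E {..n}. F (block (z # zs) g)) =
      (\<Sum>(k, g) \<in> {..n} \<times> ({..<length zs} \<rightarrow>\<^sub>E {..n}). F (block (z # zs) (case_nat k g)))"
    using sum.reindex_bij_betw[OF bij_betw_case_nat[of "{..n}" "length zs"],
        of "\<lambda>g. F (block (z # zs) g)"]
    by (simp add: case_prod_beta)
  also have "\<dots> = (\<Sum>k\<le>n. \<Sum>g \<in> {..<length zs} \<rightarrow>\<^sub>E {..n}. F ((block zs g)(k := z # block zs g k)))"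
    by (simp add: sum.cartesian_product block_Cons)
  also have "\<dots> = dist_sum n F (z # zs)"
    by (simp add: Cons.IH[of "\<lambda>\<beta>. F (\<beta>(k := z # \<beta> k))" for k])
  finally show ?case .
qed

lemma dist_sum_add:
  "dist_sum n (\<lambda>\<beta>. F \<beta> + G \<beta>) zs = dist_sum n F zs + dist_sum n G zs"
  by (induction zs arbitrary: F G) (simp_all add: sum.distrib)

lemma dist_sum_mult_left:
  "dist_sum n (\<lambda>\<beta>. c * F \<beta>) zs = c * dist_sum n F zs" for c :: "'b::semiring_0"
  by (induction zs arbitrary: F) (simp_all add: sum_distrib_left)

section \<open>Compatibility with the symmetric algebra\<close>

definition tensor_gens :: "(rat \<Rightarrow> 'a::comm_ring \<Rightarrow> 'a) \<Rightarrow> ('a list \<Rightarrow>\<^sub>0 rat) set" where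
  "tensor_gens sc =
     range (\<lambda>(a, b). word [a + b] - word [a] - word [b]) \<union>
     range (\<lambda>(q, a). word [sc q a] - scalar q * word [a])"

definition sym_gens :: "('a list \<Rightarrow>\<^sub>0 rat) set" where
  "sym_gens = range (\<lambda>(a, b). word [a, b] - word [b, a])"

definition env_gens :: "('a::comm_ring \<Rightarrow> 'a) \<Rightarrow> ('a list \<Rightarrow>\<^sub>0 rat) set" where
  "env_gens D = range (\<lambda>(a, b). word [a, b] - word [b, a] - word [lie_bracket D a b])"

lemma foldr_mult_add: "foldr (*) xs (c + d) = foldr (*) xs c + foldr (*) xs d"
  for c d :: "'b::comm_ring"
  by (induction xs) (simp_all add: distrib_left)

context differential_rat_algebra
begin

definition sym_kernel :: "('a list \<Rightarrow>\<^sub>0 rat) set" where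
  "sym_kernel = gen_ideal (tensor_gens sc \<union> sym_gens)"

text \<open>Equality of classes in the symmetric algebra, expressed as a congruence on the free
  algebra; \<open>sym_class_eq_iff\<close> makes the link.\<close>

definition sym_eq :: "('a list \<Rightarrow>\<^sub>0 rat) \<Rightarrow> ('a list \<Rightarrow>\<^sub>0 rat) \<Rightarrow> bool" (infix "\<approx>\<^sub>S" 50) where
  "p \<approx>\<^sub>S q \<longleftrightarrow> p - q \<in> sym_kernel"

lemma sym_eq_refl [simp, intro!]: "p \<approx>\<^sub>S p"
  by (simp add: sym_eq_def sym_kernel_def gen_ideal_zero)

lemma sym_eq_sym: "p \<approx>\<^sub>S q \<Longrightarrow> q \<approx>\<^sub>S p"
  using gen_ideal_uminus[of "p - q"] by (simp add: sym_eq_def sym_kernel_def)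

lemma sym_eq_trans [trans]: "p \<approx>\<^sub>S q \<Longrightarrow> q \<approx>\<^sub>S r \<Longrightarrow> p \<approx>\<^sub>S r"
  using gen_ideal_add[of "p - q" _ "q - r"] by (simp add: sym_eq_def sym_kernel_def)

lemma sym_eq_add: "p \<approx>\<^sub>S p' \<Longrightarrow> q \<approx>\<^sub>S q' \<Longrightarrow> p + q \<approx>\<^sub>S p' + q'"
  using gen_ideal_add[of "p - p'" _ "q - q'"] by (simp add: sym_eq_def sym_kernel_def add_diff_add)

lemma sym_eq_diff: "p \<approx>\<^sub>S p' \<Longrightarrow> q \<approx>\<^sub>S q' \<Longrightarrow> p - q \<approx>\<^sub>S p' - q'"
  using gen_ideal_diff[of "p - p'" _ "q - q'"]
  by (simp add: sym_eq_def sym_kernel_def algebra_simps)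

lemma sym_eq_mult: "p \<approx>\<^sub>S p' \<Longrightarrow> q \<approx>\<^sub>S q' \<Longrightarrow> p * q \<approx>\<^sub>S p' * q'"
  using gen_ideal_add[OF gen_ideal_mult_right[of "p - p'" _ q] gen_ideal_mult_left[of "q - q'" _ p']]
  by (simp add: sym_eq_def sym_kernel_def algebra_simps)

lemma sym_eq_sum: "(\<And>i. i \<in> I \<Longrightarrow> f i \<approx>\<^sub>S g i) \<Longrightarrow> sum f I \<approx>\<^sub>S sum g I"
  by (induction I rule: infinite_finite_induct) (auto intro: sym_eq_add)

text \<open>The three clauses correspond to the three kinds of relations of the symmetric algebra,
  so they say that the linear extension of \<open>F\<close> descends to a map from the symmetric
  algebra to itself.\<close>

definition compatible :: "('a list \<Rightarrow> 'a list \<Rightarrow>\<^sub>0 rat) \<Rightarrow> bool" where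
  "compatible F \<longleftrightarrow>
     (\<forall>u a b v. F (u @ (a + b) # v) \<approx>\<^sub>S F (u @ a # v) + F (u @ b # v)) \<and>
     (\<forall>u q a v. F (u @ sc q a # v) \<approx>\<^sub>S scalar q * F (u @ a # v)) \<and>
     (\<forall>u a b v. F (u @ a # b # v) \<approx>\<^sub>S F (u @ b # a # v))"

lemma compatibleI:
  assumes "\<And>u a b v. F (u @ (a + b) # v) \<approx>\<^sub>S F (u @ a # v) + F (u @ b # v)"
    and "\<And>u q a v. F (u @ sc q a # v) \<approx>\<^sub>S scalar q * F (u @ a # v)"
    and "\<And>u a b v. F (u @ a # b # v) \<approx>\<^sub>S F (u @ b # a # v)"
  shows "compatible F"
  using assms unfolding compatible_def by blast

lemma compatibleD:
  assumes "compatible F"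
  shows "F (u @ (a + b) # v) \<approx>\<^sub>S F (u @ a # v) + F (u @ b # v)"
    and "F (u @ sc q a # v) \<approx>\<^sub>S scalar q * F (u @ a # v)"
    and "F (u @ a # b # v) \<approx>\<^sub>S F (u @ b # a # v)"
  using assms unfolding compatible_def by blast+

lemma word_between: "word u * word x * word v = word (u @ x @ v)"
  by (simp add: word_append mult.assoc)

lemma compatible_word: "compatible word"
proof (rule compatibleI)
  fix u v :: "'a list" and a b q
  have "word u * (word [a + b] - word [a] - word [b]) * word v \<in> sym_kernel"
    unfolding sym_kernel_def by (rule gen_ideal_gen) (auto simp: tensor_gens_def)
  then show "word (u @ (a + b) # v) \<approx>\<^sub>S word (u @ a # v) + word (u @ b # v)"
    by (simp add: sym_eq_def right_diff_distrib left_diff_distrib word_between diff_diff_eq distrib_left distrib_right)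
  have "word u * (word [sc q a] - scalar q * word [a]) * word v \<in> sym_kernel"
    unfolding sym_kernel_def by (rule gen_ideal_gen) (auto simp: tensor_gens_def)
  then show "word (u @ sc q a # v) \<approx>\<^sub>S scalar q * word (u @ a # v)"
    by (simp add: sym_eq_def right_diff_distrib left_diff_distrib mult_scalar_left[of "word u"]
        mult.assoc[of "scalar q"] word_between)
  have "word u * (word [a, b] - word [b, a]) * word v \<in> sym_kernel"
    unfolding sym_kernel_def by (rule gen_ideal_gen) (auto simp: sym_gens_def)
  then show "word (u @ a # b # v) \<approx>\<^sub>S word (u @ b # a # v)"
    by (simp add: sym_eq_def right_diff_distrib left_diff_distrib word_between)
qed

text \<open>For a relation \<open>g\<close>, the image of \<open>word u * g * word v\<close> is the
  difference of the two sides of one clause of \<open>compatible\<close>.\<close>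

lemma lin_ext_compatible:
  assumes F: "compatible F" and "p \<approx>\<^sub>S q"
  shows "lin_ext F p \<approx>\<^sub>S lin_ext F q"
proof -
  have "lin_ext F (scalar c * (word u * g * word v)) \<in> sym_kernel"
    if "g \<in> tensor_gens sc \<union> sym_gens" for g c u v
  proof -
    have "lin_ext F (word u * g * word v) \<in> sym_kernel"
      using that
    proof (elim UnE)
      assume "g \<in> tensor_gens sc"
      then consider a b where "g = word [a + b] - word [a] - word [b]"
        | q a where "g = word [sc q a] - scalar q * word [a]"
        by (auto simp: tensor_gens_def)
      then show ?thesis
      proof cases
        case 1
        then show ?thesis
          using compatibleD(1)[OF F, of u a b v]
          by (simp add: right_diff_distrib left_diff_distrib word_between lin_ext_diff lin_ext_word
              sym_eq_def diff_diff_eq distrib_left distrib_right lin_ext_add)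
      next
        case 2
        then show ?thesis
          using compatibleD(2)[OF F, of u q a v]
          by (simp add: right_diff_distrib left_diff_distrib mult_scalar_left[of "word u"]
              mult.assoc[of "scalar q"] word_between lin_ext_diff lin_ext_scalar lin_ext_word
              sym_eq_def)
      qed
    next
      assume "g \<in> sym_gens"
      then obtain a b where "g = word [a, b] - word [b, a]" by (auto simp: sym_gens_def)
      then show ?thesis
        using compatibleD(3)[OF F, of u a b v]
        by (simp add: right_diff_distrib left_diff_distrib word_between lin_ext_diff lin_ext_word
            sym_eq_def)
    qed
    then show ?thesis
      by (simp add: lin_ext_scalar sym_kernel_def gen_ideal_mult_left)
  qed
  note gen = this
  have "lin_ext F (p - q) \<in> sym_kernel"
  proof (rule additive_on_gen_ideal[where \<phi> = "lin_ext F", OF _ lin_ext_add _ _ gen])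
    show "p - q \<in> gen_ideal (tensor_gens sc \<union> sym_gens)"
      using assms(2) by (simp add: sym_eq_def sym_kernel_def)
  qed (simp_all add: sym_kernel_def gen_ideal_zero gen_ideal_add)
  then show ?thesis by (simp add: sym_eq_def lin_ext_diff)
qed

section \<open>Compatibility of sums over distributions\<close>

definition compatible_blocks :: "nat \<Rightarrow> ((nat \<Rightarrow> 'a list) \<Rightarrow> 'a list \<Rightarrow>\<^sub>0 rat) \<Rightarrow> bool" where
  "compatible_blocks n F \<longleftrightarrow> (\<forall>k\<le>n. \<forall>\<beta>. compatible (\<lambda>x. F (\<beta>(k := x))))"

lemma compatible_Cons: "compatible F \<Longrightarrow> compatible (\<lambda>x. F (z # x))"
  unfolding compatible_def by (metis append_Cons)

lemma compatible_blocks_Cons: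
  assumes F: "compatible_blocks n F" and "k \<le> n"
  shows "compatible_blocks n (\<lambda>\<beta>. F (\<beta>(k := z # \<beta> k)))"
  unfolding compatible_blocks_def
proof (intro allI impI)
  fix j \<beta> assume "j \<le> n"
  show "compatible (\<lambda>x. F ((\<beta>(j := x))(k := z # (\<beta>(j := x)) k)))"
  proof (cases "j = k")
    case True
    then show ?thesis
      using compatible_Cons[of "\<lambda>x. F (\<beta>(k := x))" z] F \<open>k \<le> n\<close> unfolding compatible_blocks_def by simp
  next
    case False
    have "compatible (\<lambda>x. F ((\<beta>(k := z # \<beta> k))(j := x)))"
      using F \<open>j \<le> n\<close> unfolding compatible_blocks_def by blast
    then show ?thesis using False by (simp add: fun_upd_twist)
  qed
qed

lemma dist_sum_sym_eq: "(\<And>\<beta>. F \<beta> \<approx>\<^sub>S G \<beta>) \<Longrightarrow> dist_sum n F zs \<approx>\<^sub>S dist_sum n G zs"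
proof (induction zs arbitrary: F G)
  case (Cons z zs)
  show ?case by (simp, intro sym_eq_sum Cons.IH Cons.prems)
qed simp

text \<open>Letters of \<open>u\<close> are distributed first and keep \<open>F\<close> compatible
  in each block, which reduces to \<open>u = []\<close>. Linearity is then linearity in the block
  receiving the letter. Swapping two letters exchanges their block numbers; only when both enter the
  same block is the symmetry of \<open>F\<close> in that block used.\<close>

lemma compatible_dist_sum:
  assumes "compatible_blocks n F"
  shows "compatible (dist_sum n F)"
proof (rule compatibleI)
  fix u v :: "'a list" and a b q
  have base: "compatible (\<lambda>x. F (\<beta>(k := x)))" if "compatible_blocks n F" "k \<le> n" for F \<beta> k
    using that unfolding compatible_blocks_def by blast
  show "dist_sum n F (u @ (a + b) # v) \<approx>\<^sub>S dist_sum n F (u @ a # v) + dist_sum n F (u @ b # v)"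
    using assms
  proof (induction u arbitrary: F)
    case Nil
    have *: "F (\<beta>(k := (a + b) # \<beta> k)) \<approx>\<^sub>S F (\<beta>(k := a # \<beta> k)) + F (\<beta>(k := b # \<beta> k))" if "k \<le> n" for k \<beta>
      using compatibleD(1)[OF base[OF Nil that, of \<beta>], of "[]" a b "\<beta> k"] by (simp del: fun_upd_apply)
    have "dist_sum n F ((a + b) # v) \<approx>\<^sub>S
        (\<Sum>k\<le>n. dist_sum n (\<lambda>\<beta>. F (\<beta>(k := a # \<beta> k)) + F (\<beta>(k := b # \<beta> k))) v)"
      unfolding dist_sum.simps
      by (intro sym_eq_sum dist_sum_sym_eq *) simp
    then show ?case by (simp add: dist_sum_add sum.distrib)
  next
    case (Cons z u)
    show ?case
      unfolding append_Cons dist_sum.simps sum.distrib[symmetric]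
      by (intro sym_eq_sum Cons.IH compatible_blocks_Cons Cons.prems) simp
  qed
  show "dist_sum n F (u @ sc q a # v) \<approx>\<^sub>S scalar q * dist_sum n F (u @ a # v)"
    using assms
  proof (induction u arbitrary: F)
    case Nil
    have *: "F (\<beta>(k := sc q a # \<beta> k)) \<approx>\<^sub>S scalar q * F (\<beta>(k := a # \<beta> k))" if "k \<le> n" for k \<beta>
      using compatibleD(2)[OF base[OF Nil that, of \<beta>], of "[]" q a "\<beta> k"] by (simp del: fun_upd_apply)
    have "dist_sum n F (sc q a # v) \<approx>\<^sub>S
        (\<Sum>k\<le>n. dist_sum n (\<lambda>\<beta>. scalar q * F (\<beta>(k := a # \<beta> k))) v)"
      unfolding dist_sum.simps
      by (intro sym_eq_sum dist_sum_sym_eq *) simp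
    then show ?case by (simp add: dist_sum_mult_left sum_distrib_left)
  next
    case (Cons z u)
    show ?case
      unfolding append_Cons dist_sum.simps sum_distrib_left
      by (intro sym_eq_sum Cons.IH compatible_blocks_Cons Cons.prems) simp
  qed
  show "dist_sum n F (u @ a # b # v) \<approx>\<^sub>S dist_sum n F (u @ b # a # v)"
    using assms
  proof (induction u arbitrary: F)
    case Nil
    \<comment> \<open>In \<open>H c d k l\<close> the first letter \<open>c\<close> enters block
      \<open>k\<close> and the second letter \<open>d\<close> enters block \<open>l\<close>; if the
      blocks coincide, \<open>c\<close> stands before \<open>d\<close>.\<close>
    define H where "H c d k l \<beta> = F ((\<beta>(l := d # \<beta> l))(k := c # (\<beta>(l := d # \<beta> l)) k))"
      for c d k l \<beta>
    have H: "H a b k l \<beta> \<approx>\<^sub>S H b a l k \<beta>" if "k \<le> n" for k l \<beta>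
    proof (cases "k = l")
      case True
      then show ?thesis
        using compatibleD(3)[OF base[OF Nil that, of \<beta>], of "[]"]
        by (simp add: H_def del: fun_upd_apply) (simp add: fun_upd_def)
    next
      case False
      then show ?thesis by (simp add: H_def fun_upd_twist)
    qed
    have "dist_sum n F (a # b # v) = (\<Sum>k\<le>n. \<Sum>l\<le>n. dist_sum n (H a b k l) v)"
      by (simp add: H_def[abs_def])
    also have "\<dots> \<approx>\<^sub>S (\<Sum>k\<le>n. \<Sum>l\<le>n. dist_sum n (H b a l k) v)"
      by (intro sym_eq_sum dist_sum_sym_eq H) simp
    also have "(\<Sum>k\<le>n. \<Sum>l\<le>n. dist_sum n (H b a l k) v) = (\<Sum>k\<le>n. \<Sum>l\<le>n. dist_sum n (H b a k l) v)"
      by (rule sum.swap)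
    also have "\<dots> = dist_sum n F (b # a # v)"
      by (simp add: H_def[abs_def])
    finally show ?case by simp
  next
    case (Cons z u)
    show ?case
      unfolding append_Cons dist_sum.simps
      by (intro sym_eq_sum Cons.IH compatible_blocks_Cons Cons.prems) simp
  qed
qed

lemma star_words_eq_dist_sum:
  "star_words D zs ws = dist_sum (length ws)
     (\<lambda>\<beta>. word (map (\<lambda>j. brace D (\<beta> j) (ws ! j)) [0..<length ws] @ \<beta> (length ws))) zs"
  unfolding star_words_def by (rule sum_blocks)

section \<open>Independence of the star product of its first representative\<close>

lemma mult_sc: "a * sc q b = sc q (a * b)"
  by (metis mult.commute sc_mult)

lemma foldr_mult_sc: "foldr (*) xs (sc q c) = sc q (foldr (*) xs c)"
  by (induction xs) (simp_all add: mult_sc)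

lemma brace_letter_add:
  "brace D (u @ (a + b) # v) w = brace D (u @ a # v) w + brace D (u @ b # v) w"
  by (simp add: brace_def foldr_mult_add distrib_right)

lemma brace_letter_sc: "brace D (u @ sc q a # v) w = sc q (brace D (u @ a # v) w)"
  by (simp add: brace_def foldr_mult_sc sc_mult)

lemma brace_letter_swap: "brace D (u @ a # b # v) w = brace D (u @ b # a # v) w"
  by (simp add: brace_def mult.left_commute)

text \<open>A block with number below \<open>n\<close> enters only through a brace, which is linear
  and symmetric in it. The leftover block \<open>n\<close> is a final segment of the word, where
  \<open>compatible_word\<close> applies.\<close>

lemma compatible_star_words: "compatible (\<lambda>zs. star_words D zs ws)"
proof -
  define n where "n = length ws"
  define F where "F \<beta> = word (map (\<lambda>j. brace D (\<beta> j) (ws ! j)) [0..<n] @ \<beta> n)" for \<beta>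
  have "compatible (\<lambda>x. F (\<beta>(k := x)))" if "k \<le> n" for k \<beta>
  proof (cases "k = n")
    case True
    define A where "A = map (\<lambda>j. brace D (\<beta> j) (ws ! j)) [0..<n]"
    have F: "F (\<beta>(k := x)) = word (A @ x)" for x
      using True by (auto simp: F_def A_def intro!: arg_cong[where f = word])
    show ?thesis
      unfolding F using compatibleD[OF compatible_word, of "A @ u" for u]
      by (intro compatibleI) simp_all
  next
    case False
    with that have "k < n" by simp
    define A where "A = map (\<lambda>j. brace D (\<beta> j) (ws ! j)) [0..<k]"
    define B where "B = map (\<lambda>j. brace D (\<beta> j) (ws ! j)) [Suc k..<n] @ \<beta> n"
    have "[0..<n] = [0..<k] @ k # [Suc k..<n]"
      using \<open>k < n\<close> upt_add_eq_append[of 0 k "n - k"] by (simp add: upt_conv_Cons)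
    then have F: "F (\<beta>(k := x)) = word (A @ brace D x (ws ! k) # B)" for x
      using False by (auto simp: F_def A_def B_def intro!: arg_cong[where f = word])
    show ?thesis
      unfolding F
      by (intro compatibleI)
        (simp_all only: brace_letter_add brace_letter_sc compatibleD[OF compatible_word]
          brace_letter_swap sym_eq_refl)
  qed
  then have "compatible (dist_sum n F)"
    by (intro compatible_dist_sum) (simp add: compatible_blocks_def)
  then show ?thesis
    by (simp add: star_words_eq_dist_sum F_def[abs_def] n_def)
qed

text \<open>With \<open>q\<close> fixed, the product is a combination of linear extensions of
  compatible maps in \<open>p\<close>. Invariance in the second argument is handled by
  \<open>left_star_sym_eq\<close> when the first is a letter.\<close>

lemma star_free_sym_eq_left:
  assumes "p \<approx>\<^sub>S p'"
  shows "star_free D p q \<approx>\<^sub>S star_free D p' q"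
proof -
  have "star_free D p q =
      (\<Sum>ws \<in> Poly_Mapping.keys q. scalar (Poly_Mapping.lookup q ws) * lin_ext (\<lambda>zs. star_words D zs ws) p)" for p
  proof -
    have "star_free D p q = (\<Sum>ws \<in> Poly_Mapping.keys q. \<Sum>zs \<in> Poly_Mapping.keys p.
        scalar (Poly_Mapping.lookup p zs * Poly_Mapping.lookup q ws) * star_words D zs ws)"
      unfolding star_free_def by (rule sum.swap)
    also have "\<dots> = (\<Sum>ws \<in> Poly_Mapping.keys q. scalar (Poly_Mapping.lookup q ws) * lin_ext (\<lambda>zs. star_words D zs ws) p)"
      unfolding lin_ext_def sum_distrib_left
      by (intro sum.cong refl) (simp add: mult.assoc[symmetric] scalar_mult[symmetric] mult.commute)
    finally show ?thesis .
  qed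
  then show ?thesis
    by (simp, intro sym_eq_sum sym_eq_mult sym_eq_refl lin_ext_compatible compatible_star_words assms)
qed

end

section \<open>Derivations and the star product by a letter\<close>

text \<open>Vanishing on scalars together with the product rule yields linearity over the
  rationals.\<close>

definition derivation :: "(('a list \<Rightarrow>\<^sub>0 rat) \<Rightarrow> 'a list \<Rightarrow>\<^sub>0 rat) \<Rightarrow> bool" where
  "derivation \<delta> \<longleftrightarrow> (\<forall>p q. \<delta> (p + q) = \<delta> p + \<delta> q) \<and>
     (\<forall>c. \<delta> (scalar c) = 0) \<and> (\<forall>p q. \<delta> (p * q) = \<delta> p * q + p * \<delta> q)"

lemma derivation_zero: "derivation \<delta> \<Longrightarrow> \<delta> 0 = 0"
  unfolding derivation_def by (metis add_cancel_left_left)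

lemma derivation_one: "derivation \<delta> \<Longrightarrow> \<delta> 1 = 0"
proof -
  assume "derivation \<delta>"
  then have "\<delta> (1 * 1) = \<delta> 1 * 1 + 1 * \<delta> 1" unfolding derivation_def by blast
  then show ?thesis by simp
qed

lemma derivation_uminus: "derivation \<delta> \<Longrightarrow> \<delta> (- p) = - \<delta> p"
  using derivation_zero[of \<delta>] unfolding derivation_def
  by (metis add.right_inverse add_eq_0_iff)

lemma derivation_diff: "derivation \<delta> \<Longrightarrow> \<delta> (p - q) = \<delta> p - \<delta> q"
  using derivation_uminus[of \<delta> q] unfolding derivation_def
  by (metis uminus_add_conv_diff diff_conv_add_uminus)

lemma derivation_plus:
  assumes "derivation \<delta>" "derivation \<epsilon>"
  shows "derivation (\<lambda>p. \<delta> p + \<epsilon> p)"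
  using assms unfolding derivation_def by (simp add: algebra_simps)

lemma derivation_scaled:
  assumes "derivation \<delta>"
  shows "derivation (\<lambda>p. scalar c * \<delta> p)"
  using assms unfolding derivation_def
  by (auto simp: distrib_left mult.assoc mult_scalar_left[of p c q for p q])

lemma derivation_commutator:
  assumes "derivation \<delta>" "derivation \<epsilon>"
  shows "derivation (\<lambda>p. \<delta> (\<epsilon> p) - \<epsilon> (\<delta> p))"
  using assms derivation_zero[OF assms(1)] derivation_zero[OF assms(2)]
  unfolding derivation_def by (simp add: algebra_simps)

text \<open>By the product rule the image of \<open>x * g * y\<close> has three terms: two still
  contain the factor \<open>g\<close>, and the third contains \<open>\<delta> g\<close>.\<close>

lemma derivation_gen_ideal:
  assumes \<delta>: "derivation \<delta>" and "\<And>g. g \<in> G \<Longrightarrow> \<delta> g \<in> gen_ideal G" and "p \<in> gen_ideal G"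
  shows "\<delta> p \<in> gen_ideal G"
  using assms(3)
proof induction
  case (gen_ideal_gen g x y)
  have "\<delta> (x * g * y) = \<delta> x * g * y + x * \<delta> g * y + x * g * \<delta> y"
    using \<delta> unfolding derivation_def by (simp add: algebra_simps)
  then show ?case
    using gen_ideal_gen assms(2)[of g]
    by (metis gen_ideal.gen_ideal_add gen_ideal.gen_ideal_gen gen_ideal_mult_left gen_ideal_mult_right)
qed (use \<delta> in \<open>auto simp: derivation_zero derivation_def intro: gen_ideal_zero gen_ideal_add\<close>)

lemma the_elem_image:
  assumes "x \<in> A" "\<And>y. y \<in> A \<Longrightarrow> f y = f x"
  shows "the_elem (f ` A) = f x"
proof -
  have "f ` A = {f x}" using assms by blast
  then show ?thesis by simp
qed

section \<open>The tensor, symmetric and enveloping algebras as quotients of the free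
  algebra\<close>

lemma tensor_class_eq: "tensor_class sc = quot1 (tensor_gens sc)"
  by (simp add: fun_eq_iff tensor_class_def tensor_ideal_def quot1_def tensor_gens_def free_alg_def)

lemma tensor_alg_eq: "tensor_alg sc = quot1_ring (tensor_gens sc)"
  by (simp add: tensor_alg_def tensor_ideal_def quot1_ring_def tensor_gens_def free_alg_def)

lemma sym_ideal_eq:
  "sym_ideal sc = Idl\<^bsub>quot1_ring (tensor_gens sc)\<^esub> (quot1 (tensor_gens sc) ` sym_gens)"
  unfolding sym_ideal_def sym_gens_def image_image tensor_alg_eq tensor_def tensor_class_eq
  by (simp add: quot1_minus case_prod_beta)

lemma sym_class_eq: "sym_class sc = quot2 (tensor_gens sc) sym_gens"
  by (simp add: fun_eq_iff sym_class_def quot2_def sym_ideal_eq tensor_alg_eq tensor_class_eq)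

lemma sym_alg_eq: "sym_alg sc = quot2_ring (tensor_gens sc) sym_gens"
  by (simp add: sym_alg_def quot2_ring_def sym_ideal_eq tensor_alg_eq)

lemma env_ideal_eq:
  "env_ideal sc D = Idl\<^bsub>quot1_ring (tensor_gens sc)\<^esub> (quot1 (tensor_gens sc) ` env_gens D)"
  unfolding env_ideal_def env_gens_def image_image tensor_alg_eq tensor_def tensor_class_eq
  by (simp add: quot1_minus case_prod_beta)

lemma env_tensor_eq: "env_tensor sc D fs = quot2 (tensor_gens sc) (env_gens D) (word fs)"
  by (simp add: env_tensor_def quot2_def env_ideal_eq tensor_alg_eq tensor_def tensor_class_eq)

context differential_rat_algebra
begin

lemma sym_class_eq_iff: "sym_class sc p = sym_class sc q \<longleftrightarrow> p \<approx>\<^sub>S q"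
  by (simp add: sym_class_eq quot2_eq_iff sym_eq_def sym_kernel_def)

lemma Union_sym_class: "\<Union> (sym_class sc p) = {q. q \<approx>\<^sub>S p}"
  by (simp add: sym_class_eq Union_quot2 sym_eq_def sym_kernel_def)

lemma sym_eq_diff_zero: "p \<approx>\<^sub>S q \<Longrightarrow> p - q \<approx>\<^sub>S 0"
  by (simp add: sym_eq_def)

text \<open>Letters and scalars generate the free algebra, and the product rule carries agreement on
  two factors over to their product because the congruence respects sums and products.\<close>

lemma derivation_eqI:
  assumes \<delta>: "derivation \<delta>" and \<epsilon>: "derivation \<epsilon>"
    and letters: "\<And>a. \<delta> (word [a]) \<approx>\<^sub>S \<epsilon> (word [a])"
  shows "\<delta> p \<approx>\<^sub>S \<epsilon> p"
proof -
  have mult: "\<delta> (p * q) \<approx>\<^sub>S \<epsilon> (p * q)" if "\<delta> p \<approx>\<^sub>S \<epsilon> p" "\<delta> q \<approx>\<^sub>S \<epsilon> q" for p q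
    using \<delta> \<epsilon> that unfolding derivation_def by (auto intro: sym_eq_add sym_eq_mult)
  show ?thesis
  proof (induction p rule: free_alg_induct)
    case zero
    show ?case using \<delta> \<epsilon> by (simp add: derivation_zero)
  next
    case (add p q)
    then show ?case using \<delta> \<epsilon> unfolding derivation_def by (auto intro: sym_eq_add)
  next
    case (word c u)
    have "\<delta> (word u) \<approx>\<^sub>S \<epsilon> (word u)"
    proof (induction u)
      case Nil
      show ?case using \<delta> \<epsilon> by (simp add: word_Nil derivation_one)
    next
      case (Cons a u)
      then show ?case using letters mult by (subst (1 2) word_Cons) blast
    qed
    moreover have "\<delta> (scalar c) \<approx>\<^sub>S \<epsilon> (scalar c)"
      using \<delta> \<epsilon> unfolding derivation_def by simp
    ultimately show ?case using mult by blast
  qed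
qed

section \<open>Star multiplication by a letter from the left\<close>

primrec der_word :: "'a \<Rightarrow> 'a list \<Rightarrow> 'a list \<Rightarrow>\<^sub>0 rat" where
  "der_word f [] = 0"
| "der_word f (w # ws) = word ((f * D w) # ws) + word [w] * der_word f ws"

definition der :: "'a \<Rightarrow> ('a list \<Rightarrow>\<^sub>0 rat) \<Rightarrow> 'a list \<Rightarrow>\<^sub>0 rat" where
  "der f = lin_ext (der_word f)"

definition left_star :: "'a \<Rightarrow> ('a list \<Rightarrow>\<^sub>0 rat) \<Rightarrow> 'a list \<Rightarrow>\<^sub>0 rat" where
  "left_star f p = der f p + p * word [f]"

lemma der_word_append: "der_word f (u @ v) = der_word f u * word v + word u * der_word f v"
proof (induction u)
  case (Cons w u)
  then show ?case
    using word_append[of "(f * D w) # u" v] word_Cons[of w u]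
    by (simp add: distrib_left distrib_right mult.assoc)
qed (simp add: word_Nil)

lemma der_word_sum: "der_word f ws = (\<Sum>k<length ws. word (ws[k := f * D (ws ! k)]))"
proof (induction ws)
  case (Cons w ws)
  have "word [w] * word (ws[k := x]) = word (w # ws[k := x])" for k x
    using word_Cons[of w "ws[k := x]"] by simp
  then show ?case
    using Cons by (simp add: sum.lessThan_Suc_shift sum_distrib_left del: sum.lessThan_Suc)
qed simp

text \<open>The single letter either goes to a block \<open>k < n\<close>, where the brace turns
  \<open>ws ! k\<close> into \<open>f * D (ws ! k)\<close>, or to the leftover block, where it is
  appended.\<close>

lemma star_words_letter: "star_words D [f] ws = der_word f ws + word (ws @ [f])"
proof -
  define n where "n = length ws"
  have "star_words D [f] ws = (\<Sum>k\<le>n. word (map (\<lambda>j. brace D (((\<lambda>_. [])(k := [f])) j) (ws ! j)) [0..<n]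
      @ ((\<lambda>_. [])(k := [f])) n))"
    by (simp add: star_words_eq_dist_sum n_def)
  also have "\<dots> = (\<Sum>k<n. word (ws[k := f * D (ws ! k)])) + word (ws @ [f])"
  proof -
    \<comment> \<open>For \<open>k = n\<close> no brace receives a letter and the update past the
      end changes nothing, so both kinds of summands share one formula.\<close>
    have "map (\<lambda>j. brace D (((\<lambda>_. [])(k := [f])) j) (ws ! j)) [0..<n] = ws[k := f * D (ws ! k)]" for k
      by (rule nth_equalityI) (auto simp: n_def brace_def nth_list_update)
    then have "(\<Sum>k\<le>n. word (map (\<lambda>j. brace D (((\<lambda>_. [])(k := [f])) j) (ws ! j)) [0..<n]
        @ ((\<lambda>_. [])(k := [f])) n)) = (\<Sum>k<Suc n. word (ws[k := f * D (ws ! k)] @ (if n = k then [f] else [])))"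
      by (intro sum.cong) auto
    then show ?thesis by (simp add: n_def list_update_beyond)
  qed
  finally show ?thesis by (simp add: der_word_sum n_def)
qed

lemma der_add: "der f (p + q) = der f p + der f q"
  by (simp add: der_def lin_ext_add)

lemma der_mult: "der f (p * q) = der f p * q + p * der f q"
proof (induction p rule: free_alg_induct)
  case (word c u)
  show ?case
  proof (induction q rule: free_alg_induct)
    case (word d v)
    have "der f (word u * word v) = der f (word u) * word v + word u * der f (word v)"
      by (simp add: der_def lin_ext_word word_append[symmetric] der_word_append)
    then show ?case
      by (simp add: der_def lin_ext_scalar mult_scalar_left[of "word u"]
          mult_scalar_left[of "lin_ext (der_word f) (word u)"] mult.assoc distrib_left)
  qed (simp_all add: der_def lin_ext_zero lin_ext_add algebra_simps)
qed (simp_all add: der_def lin_ext_zero lin_ext_add algebra_simps)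

lemma derivation_der: "derivation (der f)"
proof -
  have "der f (scalar c) = 0" for c
    using lin_ext_scalar[of "der_word f" c "word []"] lin_ext_word[of "der_word f" "[]"]
    by (simp add: der_def word_Nil)
  then show ?thesis by (simp add: derivation_def der_add der_mult)
qed

lemma der_letter: "der f (word [w]) = word [f * D w]"
  by (simp add: der_def lin_ext_word)

lemma letter_add: "word [a + b] \<approx>\<^sub>S word [a] + word [b]"
  using compatibleD(1)[OF compatible_word, of "[]" a b "[]"] by simp

lemma letter_sc: "word [sc q a] \<approx>\<^sub>S scalar q * word [a]"
  using compatibleD(2)[OF compatible_word, of "[]" q a "[]"] by simp

lemma letter_diff: "word [a - b] \<approx>\<^sub>S word [a] - word [b]"
  using sym_eq_diff[OF sym_eq_sym[OF letter_add[of "a - b" b]] sym_eq_refl[of "word [b]"]] by simp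

lemma letter_swap: "word [a] * word [b] \<approx>\<^sub>S word [b] * word [a]"
  using compatibleD(3)[OF compatible_word, of "[]" a b "[]"] by (simp add: word_append[symmetric])

lemma D_zero: "D 0 = 0"
  using D_add[of 0 0] by simp

text \<open>Since \<open>D\<close> is linear, the linear relations go to relations of the same kind,
  and a commutator of two letters goes to a sum of two commutators of letters.\<close>

lemma der_sym_kernel:
  assumes "p \<in> sym_kernel"
  shows "der f p \<in> sym_kernel"
  unfolding sym_kernel_def
proof (rule derivation_gen_ideal[OF derivation_der])
  show "p \<in> gen_ideal (tensor_gens sc \<union> sym_gens)"
    using assms by (simp add: sym_kernel_def)
  fix g :: "'a list \<Rightarrow>\<^sub>0 rat" assume "g \<in> tensor_gens sc \<union> sym_gens"
  then consider a b where "g = word [a + b] - (word [a] + word [b])"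
    | q a where "g = word [sc q a] - scalar q * word [a]"
    | a b where "g = word [a] * word [b] - word [b] * word [a]"
    by (auto simp: tensor_gens_def sym_gens_def diff_diff_eq word_append[symmetric])
  then have "der f g \<approx>\<^sub>S 0"
  proof cases
    case 1
    then have "der f g = word [f * D a + f * D b] - (word [f * D a] + word [f * D b])"
      by (simp add: derivation_diff[OF derivation_der] der_add der_letter D_add distrib_left)
    also have "\<dots> \<approx>\<^sub>S 0"
      by (intro sym_eq_diff_zero letter_add)
    finally show ?thesis .
  next
    case 2
    then have "der f g = word [sc q (f * D a)] - scalar q * word [f * D a]"
      by (simp add: der_def lin_ext_diff lin_ext_scalar lin_ext_word D_sc mult_sc)
    also have "\<dots> \<approx>\<^sub>S 0"
      by (intro sym_eq_diff_zero letter_sc)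
    finally show ?thesis .
  next
    case 3
    have "der f g = (word [f * D a] * word [b] + word [a] * word [f * D b])
        - (word [b] * word [f * D a] + word [f * D b] * word [a])"
      unfolding 3 derivation_diff[OF derivation_der] der_mult der_letter by (simp add: add.commute)
    also have "\<dots> \<approx>\<^sub>S 0"
      by (intro sym_eq_diff_zero sym_eq_add letter_swap)
    finally show ?thesis .
  qed
  then show "der f g \<in> gen_ideal (tensor_gens sc \<union> sym_gens)"
    by (simp add: sym_eq_def sym_kernel_def)
qed

lemma der_sym_eq: "p \<approx>\<^sub>S q \<Longrightarrow> der f p \<approx>\<^sub>S der f q"
  using der_sym_kernel[of "p - q" f]
  by (simp add: sym_eq_def derivation_diff[OF derivation_der])

lemma left_star_sym_eq: "p \<approx>\<^sub>S q \<Longrightarrow> left_star f p \<approx>\<^sub>S left_star f q"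
  unfolding left_star_def by (intro sym_eq_add sym_eq_mult der_sym_eq sym_eq_refl)

lemma left_star_zero: "left_star f 0 = 0"
  by (simp add: left_star_def der_def lin_ext_zero)

lemma left_star_plus: "left_star f (p + q) = left_star f p + left_star f q"
  by (simp add: left_star_def der_add algebra_simps)

lemma left_star_diff: "left_star f (p - q) = left_star f p - left_star f q"
  by (simp add: left_star_def derivation_diff[OF derivation_der] algebra_simps)

lemma left_star_scalar: "left_star f (scalar c * p) = scalar c * left_star f p"
  by (simp add: left_star_def der_def lin_ext_scalar algebra_simps)

lemma star_free_letter: "star_free D (word [f]) q = left_star f q"
proof -
  have "star_free D (word [f]) q = lin_ext (star_words D [f]) q"
    by (simp add: star_free_def lin_ext_def word_def lookup_single)
  also have "\<dots> = left_star f q"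
  proof (induction q rule: free_alg_induct)
    case (word c u)
    show ?case
      by (simp add: lin_ext_scalar left_star_scalar lin_ext_word)
        (simp add: left_star_def star_words_letter der_def lin_ext_word word_append)
  qed (simp_all add: lin_ext_zero lin_ext_add left_star_zero left_star_plus)
  finally show ?thesis .
qed

text \<open>First the left representative is replaced by \<open>word [f]\<close>, then, for this
  fixed letter, the right one by \<open>r\<close>. Hence the set under \<open>the_elem\<close> is a
  singleton.\<close>

lemma star_letter: "star sc D (sym_class sc (word [f])) (sym_class sc r) = sym_class sc (left_star f r)"
proof -
  have "star_free D p q \<approx>\<^sub>S left_star f r" if "p \<approx>\<^sub>S word [f]" "q \<approx>\<^sub>S r" for p q
    using sym_eq_trans[OF star_free_sym_eq_left[OF that(1), of q]] left_star_sym_eq[OF that(2), of f]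
    by (simp add: star_free_letter)
  then have "sym_class sc (star_free D p q) = sym_class sc (left_star f r)"
    if "p \<approx>\<^sub>S word [f]" "q \<approx>\<^sub>S r" for p q
    using that by (simp add: sym_class_eq_iff)
  from this this[OF sym_eq_refl sym_eq_refl, symmetric] have "{sym_class sc (star_free D p q) | p q.
      p \<in> \<Union> (sym_class sc (word [f])) \<and> q \<in> \<Union> (sym_class sc r)} = {sym_class sc (left_star f r)}"
    unfolding Union_sym_class mem_Collect_eq by (blast intro: sym_eq_refl)
  then show ?thesis unfolding star_def by simp
qed

definition star_rep :: "'a list \<Rightarrow> 'a list \<Rightarrow>\<^sub>0 rat" where
  "star_rep fs = foldr left_star fs 1"

lemma star_list_eq: "star_list sc D fs = sym_class sc (star_rep fs)"
proof (induction fs)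
  case Nil
  interpret h: ring_hom_ring ring_of_type_algebra "quot2_ring (tensor_gens sc) sym_gens"
    "quot2 (tensor_gens sc) sym_gens"
    by (rule quot2_hom)
  show ?case
    using h.hom_one by (simp add: star_list_def star_rep_def sym_alg_eq sym_class_eq)
next
  case (Cons f fs)
  then show ?case using star_letter[of f "star_rep fs"] by (simp add: star_list_def star_rep_def)
qed

section \<open>The relations of the enveloping algebra on star multiplications\<close>

lemma left_star_letter_add: "left_star (a + b) p \<approx>\<^sub>S left_star a p + left_star b p"
proof -
  have "der (a + b) p \<approx>\<^sub>S der a p + der b p"
    by (rule derivation_eqI) (auto intro: derivation_plus derivation_der simp: der_letter distrib_right letter_add)
  from sym_eq_add[OF this sym_eq_mult[OF sym_eq_refl[of p] letter_add[of a b]]]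
  show ?thesis by (simp add: left_star_def algebra_simps)
qed

lemma left_star_letter_sc: "left_star (sc q a) p \<approx>\<^sub>S scalar q * left_star a p"
proof -
  have "der (sc q a) p \<approx>\<^sub>S scalar q * der a p"
    by (rule derivation_eqI) (auto intro: derivation_scaled derivation_der simp: der_letter sc_mult letter_sc)
  from sym_eq_add[OF this sym_eq_mult[OF sym_eq_refl[of p] letter_sc[of q a]]]
  show ?thesis by (simp add: left_star_def distrib_left mult_scalar_left[of p])
qed

text \<open>The commutator of two derivations is a derivation, so comparing it with
  \<open>der c\<close> reduces to letters. The remaining terms come from the appended
  letters.\<close>

lemma left_star_commutator:
  "left_star a (left_star b p) - left_star b (left_star a p) \<approx>\<^sub>S left_star (lie_bracket D a b) p"
proof -
  define c where "c = lie_bracket D a b"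
  have c: "c = a * D b - b * D a" by (simp add: c_def lie_bracket_def prelie_def)
  have "der a (der b p) - der b (der a p) \<approx>\<^sub>S der c p"
  proof (rule derivation_eqI[OF derivation_commutator[OF derivation_der derivation_der] derivation_der])
    show "der a (der b (word [w])) - der b (der a (word [w])) \<approx>\<^sub>S der c (word [w])" for w
    proof -
      \<comment> \<open>The second-order terms \<open>a * b * D (D w)\<close> cancel by
        commutativity; this is the left pre-Lie identity of the product
        \<open>a * D b\<close>.\<close>
      have "a * D (b * D w) - b * D (a * D w) = c * D w"
        by (simp add: c D_mult algebra_simps)
      then show ?thesis
        using letter_diff[of "a * D (b * D w)" "b * D (a * D w)"]
        by (simp add: der_letter sym_eq_sym)
    qed
  qed
  moreover have "p * (word [a * D b] - word [b * D a]) \<approx>\<^sub>S p * word [c]"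
    unfolding c by (rule sym_eq_mult[OF sym_eq_refl sym_eq_sym[OF letter_diff]])
  moreover have "p * (word [b] * word [a]) - p * (word [a] * word [b]) \<approx>\<^sub>S 0"
    by (intro sym_eq_diff_zero sym_eq_mult sym_eq_refl letter_swap)
  ultimately have "(der a (der b p) - der b (der a p)) + p * (word [a * D b] - word [b * D a]) +
      (p * (word [b] * word [a]) - p * (word [a] * word [b])) \<approx>\<^sub>S der c p + p * word [c] + 0"
    by (intro sym_eq_add)
  \<comment> \<open>The mixed terms \<open>der a p * word [b]\<close> and
    \<open>der b p * word [a]\<close> occur in both compositions and cancel exactly in the free
    algebra.\<close>
  then show ?thesis
    by (simp add: left_star_def c_def[symmetric] der_add der_mult der_letter algebra_simps)
qed

lemma foldr_left_star_diff: "foldr left_star u (p - q) = foldr left_star u p - foldr left_star u q"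
  by (induction u) (simp_all add: left_star_diff)

lemma foldr_left_star_plus: "foldr left_star u (p + q) = foldr left_star u p + foldr left_star u q"
  by (induction u) (simp_all add: left_star_plus)

lemma foldr_left_star_scalar: "foldr left_star u (scalar c * p) = scalar c * foldr left_star u p"
  by (induction u) (simp_all add: left_star_scalar)

lemma foldr_left_star_sym_eq: "p \<approx>\<^sub>S q \<Longrightarrow> foldr left_star u p \<approx>\<^sub>S foldr left_star u q"
  by (induction u) (simp_all add: left_star_sym_eq)

text \<open>The right factor \<open>v\<close> yields an element \<open>r\<close>, on which the
  relation holds as an identity of operators up to the congruence; the operators from
  \<open>u\<close> preserve the congruence.\<close>

lemma star_rep_gens:
  assumes "g \<in> tensor_gens sc \<union> env_gens D"
  shows "lin_ext star_rep (word u * g * word v) \<approx>\<^sub>S 0"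
proof -
  define r where "r = star_rep v"
  have rep: "star_rep (u @ x @ v) = foldr left_star u (foldr left_star x r)" for x
    by (simp add: star_rep_def r_def)
  from assms consider a b where "g = word [a + b] - (word [a] + word [b])"
    | q a where "g = word [sc q a] - scalar q * word [a]"
    | a b where "g = word [a, b] - word [b, a] - word [lie_bracket D a b]"
    by (auto simp: tensor_gens_def env_gens_def diff_diff_eq)
  then show ?thesis
  proof cases
    case 1
    then have "lin_ext star_rep (word u * g * word v) =
        foldr left_star u (left_star (a + b) r) - foldr left_star u (left_star a r + left_star b r)"
      by (simp add: right_diff_distrib left_diff_distrib distrib_left distrib_right word_between
          lin_ext_diff lin_ext_add lin_ext_word rep[of "[_]", simplified] foldr_left_star_plus)
    also have "\<dots> \<approx>\<^sub>S 0"
      by (intro sym_eq_diff_zero foldr_left_star_sym_eq left_star_letter_add)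
    finally show ?thesis .
  next
    case 2
    then have "lin_ext star_rep (word u * g * word v) =
        foldr left_star u (left_star (sc q a) r) - foldr left_star u (scalar q * left_star a r)"
      by (simp add: right_diff_distrib left_diff_distrib mult_scalar_left[of "word u"]
          mult.assoc[of "scalar q"] word_between
          lin_ext_diff lin_ext_scalar lin_ext_word rep[of "[_]", simplified] foldr_left_star_scalar)
    also have "\<dots> \<approx>\<^sub>S 0"
      by (intro sym_eq_diff_zero foldr_left_star_sym_eq left_star_letter_sc)
    finally show ?thesis .
  next
    case 3
    then have "lin_ext star_rep (word u * g * word v) =
        foldr left_star u (left_star a (left_star b r) - left_star b (left_star a r))
        - foldr left_star u (left_star (lie_bracket D a b) r)"
      by (simp add: right_diff_distrib left_diff_distrib word_between lin_ext_diff lin_ext_word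
          rep[of "[_]", simplified] rep[of "[_, _]", simplified] foldr_left_star_diff)
    also have "\<dots> \<approx>\<^sub>S 0"
      by (intro sym_eq_diff_zero foldr_left_star_sym_eq left_star_commutator)
    finally show ?thesis .
  qed
qed

lemma lin_ext_star_rep_sym_eq:
  assumes "p - q \<in> gen_ideal (tensor_gens sc \<union> env_gens D)"
  shows "lin_ext star_rep p \<approx>\<^sub>S lin_ext star_rep q"
proof -
  have "lin_ext star_rep (scalar c * (word u * g * word v)) \<in> sym_kernel"
    if "g \<in> tensor_gens sc \<union> env_gens D" for g c u v
    using star_rep_gens[OF that, of u v]
    by (simp add: sym_eq_def lin_ext_scalar sym_kernel_def gen_ideal_mult_left)
  note gen = this
  have "lin_ext star_rep (p - q) \<in> sym_kernel"
    by (rule additive_on_gen_ideal[where \<phi> = "lin_ext star_rep", OF assms lin_ext_add _ _ gen])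
      (simp_all add: sym_kernel_def gen_ideal_zero gen_ideal_add)
  then show ?thesis by (simp add: sym_eq_def lin_ext_diff)
qed

text \<open>The defining sum is the class of \<open>lin_ext star_rep p\<close>, which is the same
  for all representatives \<open>p\<close>, so it may be evaluated at
  \<open>word fs\<close>.\<close>

lemma env_to_sym_env_tensor: "env_to_sym sc D (env_tensor sc D fs) = sym_class sc (star_rep fs)"
proof -
  interpret h: ring_hom_ring ring_of_type_algebra "quot2_ring (tensor_gens sc) sym_gens"
    "quot2 (tensor_gens sc) sym_gens"
    by (rule quot2_hom)
  have mult: "sym_class sc p \<otimes>\<^bsub>sym_alg sc\<^esub> sym_class sc q = sym_class sc (p * q)" for p q
    using h.hom_mult[of p q] by (simp add: sym_class_eq sym_alg_eq)
  have ext: "(\<Oplus>\<^bsub>sym_alg sc\<^esub>fs \<in> Poly_Mapping.keys p.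
      sym_class sc (scalar (Poly_Mapping.lookup p fs)) \<otimes>\<^bsub>sym_alg sc\<^esub> star_list sc D fs)
      = sym_class sc (lin_ext star_rep p)" for p
    unfolding star_list_eq mult
    by (simp add: sym_class_eq sym_alg_eq finsum_quot2 lin_ext_def)
  have "env_to_sym sc D (env_tensor sc D fs) = sym_class sc (lin_ext star_rep (word fs))"
    unfolding env_to_sym_def ext
  proof (rule the_elem_image)
    show "word fs \<in> \<Union> (env_tensor sc D fs)"
      by (simp add: env_tensor_eq Union_quot2 gen_ideal_zero)
    show "sym_class sc (lin_ext star_rep p) = sym_class sc (lin_ext star_rep (word fs))"
      if "p \<in> \<Union> (env_tensor sc D fs)" for p
      using that by (simp add: env_tensor_eq Union_quot2 sym_class_eq_iff lin_ext_star_rep_sym_eq)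
  qed
  then show ?thesis by (simp add: lin_ext_word)
qed

section \<open>The degree one component\<close>

definition deg_one :: "('a list \<Rightarrow>\<^sub>0 rat) \<Rightarrow> 'a" where
  "deg_one p = (\<Sum>as \<in> {as \<in> Poly_Mapping.keys p. length as = 1}. sc (Poly_Mapping.lookup p as) (hd as))"

lemma deg_one_eq:
  "deg_one p = (\<Sum>u \<in> Poly_Mapping.keys p. if length u = 1 then sc (Poly_Mapping.lookup p u) (hd u) else 0)"
  unfolding deg_one_def by (rule sum.inter_filter) simp

lemma deg_one_add: "deg_one (p + q) = deg_one p + deg_one q"
  unfolding deg_one_eq by (rule setsum_keys_plus_distrib) (simp_all add: scale_left_distrib)

lemma deg_one_zero: "deg_one 0 = 0"
  by (simp add: deg_one_def)

lemma deg_one_single: "deg_one (Poly_Mapping.single u c) = (if length u = 1 then sc c (hd u) else 0)"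
  by (simp add: deg_one_eq)

lemma deg_one_word: "deg_one (word u) = (if length u = 1 then hd u else 0)"
  by (simp add: word_def deg_one_single)

lemma deg_one_uminus: "deg_one (- p) = - deg_one p"
  using deg_one_add[of p "- p"] by (simp add: deg_one_zero eq_neg_iff_add_eq_0 add.commute)

lemma deg_one_diff: "deg_one (p - q) = deg_one p - deg_one q"
  using deg_one_add[of p "- q"] by (simp add: deg_one_uminus)

lemma deg_one_scalar: "deg_one (scalar c * p) = sc c (deg_one p)"
proof (induction p rule: free_alg_induct)
  case (word d u)
  have "scalar c * (scalar d * word u) = Poly_Mapping.single u (c * d)"
    by (metis mult.assoc scalar_mult scalar_word)
  then show ?case by (simp add: scalar_word deg_one_single)
qed (simp_all add: deg_one_zero deg_one_add distrib_left scale_right_distrib)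

text \<open>Only linear relations with \<open>u\<close> and \<open>v\<close> empty involve words of
  length one, and there the component is zero by linearity in \<open>A\<close>. Commutators involve
  only words of length at least two.\<close>

lemma deg_one_sym_kernel: "p \<in> sym_kernel \<Longrightarrow> deg_one p = 0"
proof -
  assume "p \<in> sym_kernel"
  have "deg_one (scalar c * (word u * g * word v)) \<in> {0}"
    if "g \<in> tensor_gens sc \<union> sym_gens" for g c u v
  proof -
    from that consider a b where "g = word [a + b] - word [a] - word [b]"
      | q a where "g = word [sc q a] - scalar q * word [a]"
      | a b where "g = word [a, b] - word [b, a]"
      by (auto simp: tensor_gens_def sym_gens_def)
    then have "deg_one (word u * g * word v) = 0"
      by cases (simp_all add: right_diff_distrib left_diff_distrib mult_scalar_left[of "word u"]
          mult.assoc[of "scalar q" for q] word_between deg_one_diff deg_one_scalar deg_one_word)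
    then show ?thesis by (simp add: deg_one_scalar)
  qed
  note gen = this
  have "deg_one p \<in> {0}"
    by (rule additive_on_gen_ideal[where \<phi> = deg_one, OF \<open>p \<in> sym_kernel\<close>[unfolded sym_kernel_def]
          deg_one_add _ _ gen]) simp_all
  then show ?thesis by simp
qed

lemma degree_one_sym_class: "degree_one sc (sym_class sc p) = deg_one p"
  unfolding degree_one_def deg_one_def[symmetric] Union_sym_class
proof (rule the_elem_image)
  show "deg_one q = deg_one p" if "q \<in> {q. q \<approx>\<^sub>S p}" for q
    using that deg_one_sym_kernel[of "q - p"] by (simp add: sym_eq_def deg_one_diff)
qed simp

lemma deg_one_letter_mult: "deg_one (word [w] * p) = sc (Poly_Mapping.lookup p []) w"
proof (induction p rule: free_alg_induct)
  case (word c u)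
  show ?case
    by (simp add: mult_scalar_left word_append[symmetric] deg_one_scalar deg_one_word lookup_Nil_scalar
        lookup_Nil_word)
qed (simp_all add: deg_one_zero deg_one_add distrib_left lookup_add scale_left_distrib)

lemma deg_one_mult_letter: "deg_one (p * word [w]) = sc (Poly_Mapping.lookup p []) w"
proof (induction p rule: free_alg_induct)
  case (word c u)
  show ?case
    by (cases u) (simp_all add: mult.assoc word_append[symmetric] deg_one_scalar deg_one_word
        lookup_Nil_scalar lookup_Nil_word)
qed (simp_all add: deg_one_zero deg_one_add distrib_right lookup_add scale_left_distrib)

lemma lookup_Nil_der_word: "Poly_Mapping.lookup (der_word f ws) [] = 0"
  by (cases ws) (simp_all add: lookup_add lookup_Nil_Cons lookup_Nil_letter_mult)

text \<open>This kills the second summand of \<open>deg_one_left_star\<close> for every factor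
  except the innermost one, which acts on \<open>1\<close>.\<close>

lemma lookup_Nil_left_star: "Poly_Mapping.lookup (left_star f p) [] = 0"
proof -
  have "Poly_Mapping.lookup (der f p) [] = 0"
    by (induction p rule: free_alg_induct)
      (simp_all add: der_def lin_ext_zero lin_ext_add lin_ext_scalar lin_ext_word lookup_add
        lookup_Nil_scalar lookup_Nil_der_word)
  then show ?thesis by (simp add: left_star_def lookup_add lookup_Nil_mult_letter)
qed

text \<open>The derivation replaces letters by letters and so preserves word length; on a single
  letter it is \<open>w \<mapsto> f * D w\<close>.\<close>

lemma deg_one_der: "deg_one (der f p) = f * D (deg_one p)"
proof (induction p rule: free_alg_induct)
  case (word c u)
  have "deg_one (der_word f u) = f * D (deg_one (word u))"
  proof (cases u)
    case (Cons w ws)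
    then show ?thesis
      by (simp add: deg_one_add deg_one_word deg_one_letter_mult lookup_Nil_der_word D_zero)
  qed (simp add: deg_one_word deg_one_zero D_zero)
  then show ?case
    by (simp add: der_def lin_ext_scalar lin_ext_word deg_one_scalar D_sc mult_sc)
qed (simp_all add: der_def lin_ext_zero lin_ext_add deg_one_zero deg_one_add D_zero D_add distrib_left)

lemma deg_one_left_star: "deg_one (left_star f p) = f * D (deg_one p) + sc (Poly_Mapping.lookup p []) f"
  by (simp add: left_star_def deg_one_add deg_one_der deg_one_mult_letter)

text \<open>The value \<open>0\<close> at the empty list is the degree one component of the
  unit.\<close>

fun nested :: "'a list \<Rightarrow> 'a" where
  "nested [] = 0"
| "nested [f] = f"
| "nested (f # g # fs) = prelie D f (nested (g # fs))"

lemma deg_one_star_rep: "deg_one (star_rep fs) = nested fs"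
proof (induction fs rule: nested.induct)
  case 1
  show ?case using deg_one_word[of "[]"] by (simp add: star_rep_def word_Nil)
next
  case (2 f)
  show ?case
    \<comment> \<open>The operator acts on \<open>1\<close>: its degree one component is zero, and
      its constant term \<open>1\<close> produces \<open>f\<close>.\<close>
    using deg_one_word[of "[]"] lookup_single_eq[of "[]" "1::rat"]
    by (simp add: star_rep_def deg_one_left_star word_Nil[symmetric] word_def D_zero)
next
  case (3 f g fs)
  then show ?case
    by (simp add: star_rep_def deg_one_left_star lookup_Nil_left_star prelie_def)
qed

lemma eta_env_tensor: "eta sc D (env_tensor sc D fs) = nested fs"
  by (simp add: eta_def env_to_sym_env_tensor degree_one_sym_class deg_one_star_rep)

end

section \<open>The sum over words\<close>

text \<open>Here \<open>m\<close> copies of the derivation are pending before the first letter; \<open>m = 0\<close> gives \<^const>\<open>K\<close>.\<close>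

definition K_shift :: "nat \<Rightarrow> nat \<Rightarrow> nat list set" where
  "K_shift m i = {w. length w = i \<and> (\<forall>j. 1 \<le> j \<and> j < i \<longrightarrow> sum_list (take j w) \<le> m + (j - 1)) \<and>
     sum_list w = m + (i - 1)}"

text \<open>Of \<open>m\<close> pending derivations, \<open>k\<close> are chosen to act on the first
  letter. The other \<open>m - k\<close> pass on, joined by the one that the product
  \<open>f * D b\<close> puts before the rest.\<close>

primrec coeff_shift :: "nat \<Rightarrow> nat list \<Rightarrow> nat" where
  "coeff_shift m [] = 1"
| "coeff_shift m (k # w) = (m choose k) * coeff_shift (m - k + 1) w"

lemma K_shift_one: "K_shift m (Suc 0) = {[m]}"
  by (auto simp: K_shift_def length_Suc_conv)

text \<open>The prefix condition at \<open>j = 1\<close> is \<open>k \<le> m\<close>, and the later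
  ones are those of the tail with \<open>m - k + 1\<close> pending. It is stated for length at least
  two, since in length one the sole letter must absorb all \<open>m\<close>.\<close>

lemma Cons_mem_K_shift_iff:
  "k # w \<in> K_shift m (Suc (Suc n)) \<longleftrightarrow> k \<le> m \<and> w \<in> K_shift (m - k + 1) (Suc n)"
proof (cases "k \<le> m")
  case True
  have shift: "(\<forall>j. 1 \<le> j \<and> j < Suc N \<longrightarrow> P j) \<longleftrightarrow> (\<forall>j<N. P (Suc j))" for N P
    by (auto simp: Suc_le_eq gr0_conv_Suc)
  have "(\<forall>j. 1 \<le> j \<and> j < Suc (Suc n) \<longrightarrow> sum_list (take j (k # w)) \<le> m + (j - 1)) \<longleftrightarrow>
      (\<forall>j < Suc n. k + sum_list (take j w) \<le> m + j)"
    unfolding shift by simp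
  also have "\<dots> \<longleftrightarrow> (\<forall>j < n. k + sum_list (take (Suc j) w) \<le> m + Suc j)"
    \<comment> \<open>The instance \<open>j = 0\<close> is split off; it is the assumption
      \<open>k \<le> m\<close>.\<close>
    using True by (simp add: All_less_Suc2)
  also have "\<dots> \<longleftrightarrow> (\<forall>j < n. sum_list (take (Suc j) w) \<le> m - k + 1 + j)"
    using True by (intro all_cong) auto
  also have "\<dots> \<longleftrightarrow> (\<forall>j. 1 \<le> j \<and> j < Suc n \<longrightarrow> sum_list (take j w) \<le> m - k + 1 + (j - 1))"
    unfolding shift by simp
  finally show ?thesis
    using True by (auto simp: K_shift_def)
next
  case False
  then show ?thesis by (auto simp: K_shift_def dest: spec[of _ 1])
qed

lemma K_shift_Suc:
  "K_shift m (Suc (Suc n)) = (\<lambda>(k, w). k # w) ` (SIGMA k:{..m}. K_shift (m - k + 1) (Suc n))"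
proof
  show "K_shift m (Suc (Suc n)) \<subseteq> (\<lambda>(k, w). k # w) ` (SIGMA k:{..m}. K_shift (m - k + 1) (Suc n))"
  proof
    fix v assume v: "v \<in> K_shift m (Suc (Suc n))"
    then obtain k w where "v = k # w" by (cases v) (auto simp: K_shift_def)
    with v show "v \<in> (\<lambda>(k, w). k # w) ` (SIGMA k:{..m}. K_shift (m - k + 1) (Suc n))"
      by (auto simp: Cons_mem_K_shift_iff image_iff)
  qed
qed (auto simp: Cons_mem_K_shift_iff)

lemma finite_K_shift: "finite (K_shift m (Suc n))"
  by (induction n arbitrary: m) (simp_all add: K_shift_one K_shift_Suc)

text \<open>The upper entry of the \<open>j\<close>-th binomial coefficient counts the derivations
  pending before letter \<open>j\<close>, which is the argument that the recursion of
  \<open>coeff_shift\<close> has reached there.\<close>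

lemma coeff_shift_eq:
  assumes "w \<in> K_shift m (length w)" "w \<noteq> []"
  shows "(\<Prod>j = 1..length w. (m + (j - 1) - sum_list (take j w) + w ! (j - 1)) choose (w ! (j - 1)))
    = coeff_shift m w"
  using assms
proof (induction w arbitrary: m)
  case (Cons k w)
  define h where "h m w j = (m + (j - 1) - sum_list (take j w) + w ! (j - 1)) choose (w ! (j - 1))"
    for m :: nat and w j
  have k: "k \<le> m"
    using Cons.prems by (cases w) (auto simp: K_shift_one Cons_mem_K_shift_iff)
  have step: "h m (k # w) (Suc j) = h (m - k + 1) w j" if j: "j \<in> {1..length w}" for j
  proof -
    obtain i where "j = Suc i" using j by (cases j) auto
    then show ?thesis
      using k by (simp add: h_def)
  qed
  have "prod (h m (k # w)) {1..length (k # w)} = h m (k # w) 1 * (\<Prod>j = 1..length w. h m (k # w) (Suc j))"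
    using prod.atLeast_Suc_atMost[of 1 "Suc (length w)" "h m (k # w)"]
      prod.shift_bounds_cl_Suc_ivl[of "h m (k # w)" 1 "length w"] by simp
  \<comment> \<open>For \<open>j = 1\<close> the upper entry is \<open>m - k + k\<close>, which
    equals \<open>m\<close> only because the subtraction does not truncate.\<close>
  also have "\<dots> = (m choose k) * prod (h (m - k + 1) w) {1..length w}"
    using k step by (simp add: h_def[of m "k # w" "Suc 0"])
  also have "prod (h (m - k + 1) w) {1..length w} = coeff_shift (m - k + 1) w"
  proof (cases "w = []")
    case False
    then obtain n where n: "length w = Suc n" by (cases w) auto
    then have "w \<in> K_shift (m - k + 1) (length w)"
      using Cons.prems by (simp add: Cons_mem_K_shift_iff)
    from Cons.IH[OF this False] show ?thesis by (simp add: h_def)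
  qed simp
  finally show ?case by (simp add: h_def)
qed simp

lemma K_eq_K_shift: "K i = K_shift 0 i"
  by (simp add: K_def K_shift_def)

lemma coeff_K_eq_coeff_shift: "w \<in> K i \<Longrightarrow> 1 \<le> i \<Longrightarrow> coeff_K w = coeff_shift 0 w"
  using coeff_shift_eq[of w 0]
  by (cases "w = []") (auto simp: coeff_K_def height_def K_eq_K_shift K_shift_def)

context differential_rat_algebra
begin

lemma D_sum: "D (sum f I) = (\<Sum>i\<in>I. D (f i))"
  by (induction I rule: infinite_finite_induct) (simp_all add: D_zero D_add)

text \<open>Induction with Pascal's rule. Binomial coefficients act through \<open>sc\<close>, as
  \<open>A\<close> may have no unit.\<close>

lemma Leibniz:
  "(D ^^ m) (a * b) = (\<Sum>k\<le>m. sc (of_nat (m choose k)) ((D ^^ k) a * (D ^^ (m - k)) b))"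
proof (induction m)
  case (Suc m)
  define t where "t k = (D ^^ k) a * (D ^^ (Suc m - k)) b" for k
  define c where "c m k = (of_nat (m choose k) :: rat)" for m k
  have "(D ^^ Suc m) (a * b) = (\<Sum>k\<le>m. sc (c m k) (D ((D ^^ k) a * (D ^^ (m - k)) b)))"
    by (simp add: Suc D_sum D_sc c_def)
  also have "\<dots> = (\<Sum>k\<le>m. sc (c m k) (t (Suc k))) + (\<Sum>k\<le>m. sc (c m k) (t k))"
  proof -
    have "D ((D ^^ k) a * (D ^^ (m - k)) b) = t (Suc k) + t k" if "k \<le> m" for k
      using that by (simp add: t_def D_mult Suc_diff_le)
    then show ?thesis by (simp add: scale_right_distrib sum.distrib)
  qed
  \<comment> \<open>The added summand vanishes because \<open>m choose Suc m\<close> is zero; the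
    index can then be shifted for Pascal's rule.\<close>
  also have "(\<Sum>k\<le>m. sc (c m k) (t k)) = (\<Sum>k\<le>Suc m. sc (c m k) (t k))"
    by (simp add: c_def)
  also have "\<dots> = sc (c m 0) (t 0) + (\<Sum>k\<le>m. sc (c m (Suc k)) (t (Suc k)))"
    by (rule sum.atMost_Suc_shift)
  also have "(\<Sum>k\<le>m. sc (c m k) (t (Suc k))) + \<dots> =
      sc (c (Suc m) 0) (t 0) + (\<Sum>k\<le>m. sc (c (Suc m) (Suc k)) (t (Suc k)))"
    by (simp add: c_def scale_left_distrib sum.distrib)
  also have "\<dots> = (\<Sum>k\<le>Suc m. sc (c (Suc m) k) (t k))"
    by (rule sum.atMost_Suc_shift[symmetric])
  finally show ?case by (simp only: c_def t_def)
qed simp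

text \<open>The number \<open>m\<close> must be general for the induction: the Leibniz rule sends
  \<open>k\<close> derivations to the first factor and leaves \<open>m - k + 1\<close> on the nested
  rest.\<close>

lemma D_funpow_nested:
  assumes "fs \<noteq> []"
  shows "(D ^^ m) (nested fs) = (\<Sum>w \<in> K_shift m (length fs).
    sc (of_nat (coeff_shift m w)) (mult_list (map2 (\<lambda>k f. (D ^^ k) f) w fs)))"
  using assms
proof (induction fs arbitrary: m rule: nested.induct)
  case (2 f)
  show ?case by (simp add: K_shift_one)
next
  case (3 f g fs)
  define P where "P w fs = mult_list (map2 (\<lambda>k f. (D ^^ k) f) w fs)" for w fs
  let ?n = "length fs"
  \<comment> \<open>Membership in \<open>K_shift\<close> makes \<open>w\<close> non-empty, so
    \<open>mult_list\<close> splits off its first factor without reaching its default value at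
    \<open>[]\<close>.\<close>
  have P: "P (k # w) (f # g # fs) = (D ^^ k) f * P w (g # fs)" if "w \<in> K_shift m' (Suc ?n)" for k w m'
    using that by (cases w) (auto simp: P_def K_shift_def)
  have "(D ^^ m) (nested (f # g # fs)) =
      (\<Sum>k\<le>m. sc (of_nat (m choose k)) ((D ^^ k) f * (D ^^ (m - k + 1)) (nested (g # fs))))"
    by (simp add: prelie_def Leibniz funpow_swap1)
  also have "\<dots> = (\<Sum>k\<le>m. \<Sum>w \<in> K_shift (m - k + 1) (Suc ?n).
      sc (of_nat (coeff_shift m (k # w))) (P (k # w) (f # g # fs)))"
  proof (rule sum.cong[OF refl])
    fix k
    have IH: "(D ^^ (m - k + 1)) (nested (g # fs)) = (\<Sum>w \<in> K_shift (m - k + 1) (Suc ?n).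
        sc (of_nat (coeff_shift (m - k + 1) w)) (P w (g # fs)))"
      using "3.IH"[of "m - k + 1"] by (simp add: P_def del: funpow.simps)
    show "sc (of_nat (m choose k)) ((D ^^ k) f * (D ^^ (m - k + 1)) (nested (g # fs))) =
        (\<Sum>w \<in> K_shift (m - k + 1) (Suc ?n).
          sc (of_nat (coeff_shift m (k # w))) (P (k # w) (f # g # fs)))"
      unfolding IH by (simp add: sum_distrib_left scale_sum_right mult_sc P)
  qed
  also have "\<dots> = (\<Sum>(k, w) \<in> (SIGMA k:{..m}. K_shift (m - k + 1) (Suc ?n)).
      sc (of_nat (coeff_shift m (k # w))) (P (k # w) (f # g # fs)))"
    by (rule sum.Sigma) (simp_all add: finite_K_shift)
  also have "\<dots> = (\<Sum>w \<in> K_shift m (Suc (Suc ?n)). sc (of_nat (coeff_shift m w)) (P w (f # g # fs)))"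
    unfolding K_shift_Suc by (subst sum.reindex) (auto simp: inj_on_def case_prod_beta)
  finally show ?case by (simp add: P_def)
qed simp

end

theorem theorem5p2:
  fixes sc :: "rat \<Rightarrow> 'a::comm_ring \<Rightarrow> 'a" and D :: "'a \<Rightarrow> 'a" and fs :: "'a list"
  assumes "differential_rat_algebra sc D"
    and "length fs \<ge> 1"
  shows "eta sc D (env_tensor sc D fs) =
    (\<Sum>w \<in> K (length fs).
       sc (of_nat (coeff_K w)) (mult_list (map2 (\<lambda>k f. (D ^^ k) f) w fs)))"
proof -
  interpret differential_rat_algebra sc D by fact
  \<comment> \<open>No derivation is pending in front of the whole product, which is the case
    \<open>m = 0\<close>.\<close>
  have "eta sc D (env_tensor sc D fs) = (D ^^ 0) (nested fs)"
    by (simp add: eta_env_tensor)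
  also have "\<dots> = (\<Sum>w \<in> K (length fs).
       sc (of_nat (coeff_shift 0 w)) (mult_list (map2 (\<lambda>k f. (D ^^ k) f) w fs)))"
    unfolding K_eq_K_shift using assms(2) by (intro D_funpow_nested) auto
  also have "\<dots> = (\<Sum>w \<in> K (length fs).
       sc (of_nat (coeff_K w)) (mult_list (map2 (\<lambda>k f. (D ^^ k) f) w fs)))"
    using assms(2) by (intro sum.cong) (simp_all add: coeff_K_eq_coeff_shift)
  finally show ?thesis .
qed

end
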